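(* Let $(M,[g])$ be a connected conformal manifold (Riemannian or pseudo-Riemannian signature) of dimension $n\ge3$. (1) If $\sigma\in\mathcal{E}[1]$ is such that $\mathbb{I}=\frac1nD\sigma\ne0$ is a parallel standard tractor and the 1-jet $j^1_x\sigma$ vanishes at a point $x\in M$, then $\sigma\neq f_1f_2\tilde\sigma$ for any section $\tilde\sigma$ of $\mathcal{E}[1]$ and any functions $f_1,f_2$ which vanish at $x$. (2) If $\mathbb{I}=\frac1nD\sigma\neq0$ is parallel then $j^1\sigma$ can only vanish at isolated points. (3) In Riemannian signature, if $\mathbb{I}=\frac1nD\sigma\ne0$ is parallel and $j^1_x\sigma=0$ at a point $x\in M$, then there is a neighbourhood of $x$ such that, in this neighbourhood, $\sigma$ is non-vanishing away from $x$.
   Context: All objects (functions, sections) are smooth; abstract index notation is used. Curvature. For a metric $g$ with Levi-Civita connection $\nabla$, $(\nabla_a\nabla_b-\nabla_b\nabla_a)V^c=R_{ab}{}^c{}_dV^d$. The totally trace-free Weyl tensor $C_{abcd}$ and symmetric Schouten tensor $P_{ab}$ are defined by $R_{abcd}=C_{abcd}+2g_{c[a}P_{b]d}+2g_{d[b}P_{a]c}$; $J:=P^a{}_a$; $\Delta:=\nabla^a\nabla_a$. Densities. $[g]$ is a class of metrics modulo multiplication by positive smooth functions. $\mathcal{E}[w]$ is the line bundle whose sections correspond to functions $f(x,g)$ of a point and a metric in the class with $f(x,\Omega^2g)=\Omega^wf(x,g)$. $\boldsymbol{g}_{ab}$, a section of $\mathcal{E}_{(ab)}[2]$, is the tautological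 conformal metric. Indices are raised and lowered with $\boldsymbol{g}$. A choice of $g\in[g]$ trivialises the density bundles, and $\nabla$ acts on densities through this trivialisation. Tractors. The standard tractor bundle $\mathcal{E}^A$ is the quotient of the 2-jet bundle $J^2\mathcal{E}[1]$ by the image of the trace-free symmetric part $\mathcal{E}_{(ab)_0}[1]$ in $J^2\mathcal{E}[1]$; its sections are standard tractors. The operator $\frac1nD:\mathcal{E}[1]\to\mathcal{E}^A$ is induced by the universal 2-jet operator followed by the projection; a choice of $g\in[g]$ splits $\mathcal{E}^A$ as $\mathcal{E}[1]\oplus\mathcal{E}_a[1]\oplus\mathcal{E}[-1]$ so that $\frac1nD\sigma=(\sigma,\nabla_a\sigma,-\frac1n(\Delta+J)\sigma)$. The (conformally invariant) tractor connection is $$\nabla_a(\sigma,\mu_b,\rho)=(\nabla_a\sigma-\mu_a,\ \nabla_a\mu_b+\boldsymbol{g}_{ab}\rho+P_{ab}\sigma,\ \nabla_a\rho-P_{ab}\mu^b),$$ and a tractor is parallel if it is annihilated by this connection. *)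

theory Defs
  imports "HOL-Analysis.Analysis"
begin

section \<open>Smooth manifolds\<close>

text \<open>
  A manifold is a type of points (a second countable Hausdorff space) together with a smooth
  atlas \<open>A\<close>. The index type \<open>'n\<close> gives the dimension \<open>n = CARD('n)\<close>. Tensors are
  given by their components in the charts; all component formulas are evaluated at points of
  the manifold, with \<open>pderiv_chart \<kappa> i\<close> the coordinate vector field \<open>\<partial>\<^sub>i\<close> of \<open>\<kappa>\<close>.
\<close>

definition pd :: "'n::finite \<Rightarrow> (real^'n \<Rightarrow> real) \<Rightarrow> real^'n \<Rightarrow> real" where
  "pd i f p = frechet_derivative f (at p) (axis i 1)"

primrec Ck_on :: "nat \<Rightarrow> (real^'n::finite) set \<Rightarrow> (real^'n \<Rightarrow> real) \<Rightarrow> bool" where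
  "Ck_on 0 S f \<longleftrightarrow> continuous_on S f"
| "Ck_on (Suc k) S f \<longleftrightarrow> f differentiable_on S \<and> (\<forall>i. Ck_on k S (pd i f))"

text \<open>Only used for open \<open>S\<close>.\<close>

definition smooth_on :: "(real^'n::finite) set \<Rightarrow> (real^'n \<Rightarrow> real) \<Rightarrow> bool" where
  "smooth_on S f \<longleftrightarrow> (\<forall>k. Ck_on k S f)"

type_synonym ('m, 'n) chart = "'m set \<times> ('m \<Rightarrow> real^'n)"

abbreviation dom_of :: "('m, 'n::finite) chart \<Rightarrow> 'm set" where
  "dom_of \<equiv> fst"

abbreviation coord :: "('m, 'n::finite) chart \<Rightarrow> 'm \<Rightarrow> real^'n" where
  "coord \<equiv> snd"

definition local_rep :: "('m, 'n::finite) chart \<Rightarrow> ('m \<Rightarrow> real) \<Rightarrow> real^'n \<Rightarrow> real" where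
  "local_rep \<kappa> f = f \<circ> inv_into (dom_of \<kappa>) (coord \<kappa>)"

definition pderiv_chart ::
    "('m, 'n::finite) chart \<Rightarrow> 'n \<Rightarrow> ('m \<Rightarrow> real) \<Rightarrow> 'm \<Rightarrow> real" where
  "pderiv_chart \<kappa> i f x = pd i (local_rep \<kappa> f) (coord \<kappa> x)"

definition smooth_in_chart :: "('m, 'n::finite) chart \<Rightarrow> 'm set \<Rightarrow> ('m \<Rightarrow> real) \<Rightarrow> bool" where
  "smooth_in_chart \<kappa> U f \<longleftrightarrow> smooth_on (coord \<kappa> ` U) (local_rep \<kappa> f)"

definition smooth_atlas ::
    "('m::{t2_space, second_countable_topology}, 'n::finite) chart set \<Rightarrow> bool" where
  "smooth_atlas A \<longleftrightarrow>
     (\<forall>\<kappa>\<in>A. open (dom_of \<kappa>) \<and> open (coord \<kappa> ` dom_of \<kappa>) \<and>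
        homeomorphism (dom_of \<kappa>) (coord \<kappa> ` dom_of \<kappa>) (coord \<kappa>)
          (inv_into (dom_of \<kappa>) (coord \<kappa>))) \<and>
     (\<Union>\<kappa>\<in>A. dom_of \<kappa>) = UNIV \<and>
     (\<forall>\<kappa>\<in>A. \<forall>\<kappa>'\<in>A. \<forall>k.
        smooth_in_chart \<kappa>' (dom_of \<kappa> \<inter> dom_of \<kappa>') (\<lambda>x. coord \<kappa> x $ k))"

definition smooth_fun :: "('m, 'n::finite) chart set \<Rightarrow> ('m \<Rightarrow> real) \<Rightarrow> bool" where
  "smooth_fun A f \<longleftrightarrow> (\<forall>\<kappa>\<in>A. smooth_in_chart \<kappa> (dom_of \<kappa>) f)"

section \<open>Metrics and curvature\<close>

text \<open>
  A covariant 2-tensor field \<open>T\<close> has components \<open>T \<kappa> x $ i $ j\<close> in the chart \<open>\<kappa>\<close>. Values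
  outside the atlas or outside the chart domain are irrelevant.
\<close>

type_synonym ('m, 'n) tensor2 = "('m, 'n) chart \<Rightarrow> 'm \<Rightarrow> real^'n^'n"

definition smooth_tensor2 :: "('m, 'n::finite) chart set \<Rightarrow> ('m, 'n) tensor2 \<Rightarrow> bool" where
  "smooth_tensor2 A T \<longleftrightarrow>
     (\<forall>\<kappa>\<in>A. \<forall>i j. smooth_in_chart \<kappa> (dom_of \<kappa>) (\<lambda>x. T \<kappa> x $ i $ j)) \<and>
     (\<forall>\<kappa>\<in>A. \<forall>\<kappa>'\<in>A. \<forall>x \<in> dom_of \<kappa> \<inter> dom_of \<kappa>'. \<forall>i j.
        T \<kappa>' x $ i $ j =
          (\<Sum>k\<in>UNIV. \<Sum>l\<in>UNIV. pderiv_chart \<kappa>' i (\<lambda>y. coord \<kappa> y $ k) x *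
             pderiv_chart \<kappa>' j (\<lambda>y. coord \<kappa> y $ l) x * T \<kappa> x $ k $ l))"

definition symmetric_tensor2 :: "('m, 'n::finite) chart set \<Rightarrow> ('m, 'n) tensor2 \<Rightarrow> bool" where
  "symmetric_tensor2 A T \<longleftrightarrow> (\<forall>\<kappa>\<in>A. \<forall>x\<in>dom_of \<kappa>. transpose (T \<kappa> x) = T \<kappa> x)"

text \<open>Metrics of arbitrary signature (constant on a connected manifold by nondegeneracy).\<close>

definition metric :: "('m, 'n::finite) chart set \<Rightarrow> ('m, 'n) tensor2 \<Rightarrow> bool" where
  "metric A g \<longleftrightarrow> smooth_tensor2 A g \<and> symmetric_tensor2 A g \<and>
     (\<forall>\<kappa>\<in>A. \<forall>x\<in>dom_of \<kappa>. invertible (g \<kappa> x))"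

definition riemannian :: "('m, 'n::finite) chart set \<Rightarrow> ('m, 'n) tensor2 \<Rightarrow> bool" where
  "riemannian A g \<longleftrightarrow> (\<forall>\<kappa>\<in>A. \<forall>x\<in>dom_of \<kappa>. \<forall>v. v \<noteq> 0 \<longrightarrow> v \<bullet> (g \<kappa> x *v v) > 0)"

definition ginv :: "('m, 'n::finite) tensor2 \<Rightarrow> ('m, 'n) chart \<Rightarrow> 'm \<Rightarrow> 'n \<Rightarrow> 'n \<Rightarrow> real" where
  "ginv g \<kappa> x i j = matrix_inv (g \<kappa> x) $ i $ j"

text \<open>\<open>christoffel g \<kappa> c a b\<close> is \<open>\<Gamma>\<^sup>c\<^sub>a\<^sub>b\<close> of the Levi-Civita connection.\<close>

definition christoffel ::
    "('m, 'n::finite) tensor2 \<Rightarrow> ('m, 'n) chart \<Rightarrow> 'n \<Rightarrow> 'n \<Rightarrow> 'n \<Rightarrow> 'm \<Rightarrow> real" where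
  "christoffel g \<kappa> c a b x = (1/2) * (\<Sum>e\<in>UNIV. ginv g \<kappa> x c e *
     (pderiv_chart \<kappa> a (\<lambda>y. g \<kappa> y $ b $ e) x + pderiv_chart \<kappa> b (\<lambda>y. g \<kappa> y $ a $ e) x
        - pderiv_chart \<kappa> e (\<lambda>y. g \<kappa> y $ a $ b) x))"

text \<open>
  \<open>nabla_vec g \<kappa> V a c\<close>, \<open>nabla_form g \<kappa> \<omega> a b\<close> and \<open>nabla_mixed g \<kappa> T a b c\<close> are
  \<open>\<nabla>\<^sub>a V\<^sup>c\<close>, \<open>\<nabla>\<^sub>a \<omega>\<^sub>b\<close> and \<open>\<nabla>\<^sub>a T\<^sub>b\<^sup>c\<close>.
\<close>

definition nabla_vec ::
    "('m, 'n::finite) tensor2 \<Rightarrow> ('m, 'n) chart \<Rightarrow> ('n \<Rightarrow> 'm \<Rightarrow> real) \<Rightarrow> 'n \<Rightarrow> 'n \<Rightarrow> 'm \<Rightarrow> real" where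
  "nabla_vec g \<kappa> V a c x =
     pderiv_chart \<kappa> a (V c) x + (\<Sum>e\<in>UNIV. christoffel g \<kappa> c a e x * V e x)"

definition nabla_form ::
    "('m, 'n::finite) tensor2 \<Rightarrow> ('m, 'n) chart \<Rightarrow> ('n \<Rightarrow> 'm \<Rightarrow> real) \<Rightarrow> 'n \<Rightarrow> 'n \<Rightarrow> 'm \<Rightarrow> real" where
  "nabla_form g \<kappa> \<omega> a b x =
     pderiv_chart \<kappa> a (\<omega> b) x - (\<Sum>e\<in>UNIV. christoffel g \<kappa> e a b x * \<omega> e x)"

definition nabla_mixed ::
    "('m, 'n::finite) tensor2 \<Rightarrow> ('m, 'n) chart \<Rightarrow> ('n \<Rightarrow> 'n \<Rightarrow> 'm \<Rightarrow> real) \<Rightarrow>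
       'n \<Rightarrow> 'n \<Rightarrow> 'n \<Rightarrow> 'm \<Rightarrow> real" where
  "nabla_mixed g \<kappa> T a b c x = pderiv_chart \<kappa> a (T b c) x
     - (\<Sum>e\<in>UNIV. christoffel g \<kappa> e a b x * T e c x)
     + (\<Sum>e\<in>UNIV. christoffel g \<kappa> c a e x * T b e x)"

text \<open>
  \<open>riemann_up g \<kappa> a b c d\<close> is \<open>R\<^sub>a\<^sub>b\<^sup>c\<^sub>d\<close>: the identity
  \<open>(\<nabla>\<^sub>a\<nabla>\<^sub>b - \<nabla>\<^sub>b\<nabla>\<^sub>a) V\<^sup>c = R\<^sub>a\<^sub>b\<^sup>c\<^sub>d V\<^sup>d\<close> evaluated at the coordinate field \<open>V = \<partial>\<^sub>d\<close>.
\<close>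

definition riemann_up ::
    "('m, 'n::finite) tensor2 \<Rightarrow> ('m, 'n) chart \<Rightarrow> 'n \<Rightarrow> 'n \<Rightarrow> 'n \<Rightarrow> 'n \<Rightarrow> 'm \<Rightarrow> real" where
  "riemann_up g \<kappa> a b c d x =
     (let V = (\<lambda>e (y::'m). if e = d then 1 else 0)
      in nabla_mixed g \<kappa> (nabla_vec g \<kappa> V) a b c x - nabla_mixed g \<kappa> (nabla_vec g \<kappa> V) b a c x)"

definition riemann ::
    "('m, 'n::finite) tensor2 \<Rightarrow> ('m, 'n) chart \<Rightarrow> 'n \<Rightarrow> 'n \<Rightarrow> 'n \<Rightarrow> 'n \<Rightarrow> 'm \<Rightarrow> real" where
  "riemann g \<kappa> a b c d x = (\<Sum>e\<in>UNIV. g \<kappa> x $ c $ e * riemann_up g \<kappa> a b e d x)"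

definition totally_tracefree ::
    "('n::finite \<Rightarrow> 'n \<Rightarrow> real) \<Rightarrow> ('n \<Rightarrow> 'n \<Rightarrow> 'n \<Rightarrow> 'n \<Rightarrow> real) \<Rightarrow> bool" where
  "totally_tracefree h C \<longleftrightarrow> (\<forall>p q.
     (\<Sum>i\<in>UNIV. \<Sum>j\<in>UNIV. h i j * C i j p q) = 0 \<and>
     (\<Sum>i\<in>UNIV. \<Sum>j\<in>UNIV. h i j * C i p j q) = 0 \<and>
     (\<Sum>i\<in>UNIV. \<Sum>j\<in>UNIV. h i j * C i p q j) = 0 \<and>
     (\<Sum>i\<in>UNIV. \<Sum>j\<in>UNIV. h i j * C p i j q) = 0 \<and>
     (\<Sum>i\<in>UNIV. \<Sum>j\<in>UNIV. h i j * C p i q j) = 0 \<and>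
     (\<Sum>i\<in>UNIV. \<Sum>j\<in>UNIV. h i j * C p q i j) = 0)"

text \<open>
  \<open>P\<close> is the Schouten tensor of \<open>g\<close>, the symmetric part of the decomposition
  \<open>R\<^sub>a\<^sub>b\<^sub>c\<^sub>d = C\<^sub>a\<^sub>b\<^sub>c\<^sub>d + 2 g\<^sub>c\<^sub>[\<^sub>a P\<^sub>b\<^sub>]\<^sub>d + 2 g\<^sub>d\<^sub>[\<^sub>b P\<^sub>a\<^sub>]\<^sub>c\<close>. For \<open>n \<ge> 3\<close> such a \<open>P\<close> exists
  and its components in the charts of \<open>A\<close> are unique.
\<close>

definition schouten_tensor ::
    "('m, 'n::finite) chart set \<Rightarrow> ('m, 'n) tensor2 \<Rightarrow> ('m, 'n) tensor2 \<Rightarrow> bool" where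
  "schouten_tensor A g P \<longleftrightarrow> smooth_tensor2 A P \<and> symmetric_tensor2 A P \<and>
     (\<forall>\<kappa>\<in>A. \<forall>x\<in>dom_of \<kappa>. \<exists>C. totally_tracefree (ginv g \<kappa> x) C \<and>
        (\<forall>a b c d. riemann g \<kappa> a b c d x = C a b c d
           + (g \<kappa> x $ c $ a * P \<kappa> x $ b $ d - g \<kappa> x $ c $ b * P \<kappa> x $ a $ d)
           + (g \<kappa> x $ d $ b * P \<kappa> x $ a $ c - g \<kappa> x $ d $ a * P \<kappa> x $ b $ c)))"

definition schouten_trace ::
    "('m, 'n::finite) tensor2 \<Rightarrow> ('m, 'n) tensor2 \<Rightarrow> ('m, 'n) chart \<Rightarrow> 'm \<Rightarrow> real" where
  "schouten_trace g P \<kappa> x = (\<Sum>a\<in>UNIV. \<Sum>b\<in>UNIV. ginv g \<kappa> x a b * P \<kappa> x $ a $ b)"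

definition laplacian ::
    "('m, 'n::finite) tensor2 \<Rightarrow> ('m, 'n) chart \<Rightarrow> ('m \<Rightarrow> real) \<Rightarrow> 'm \<Rightarrow> real" where
  "laplacian g \<kappa> f x = (\<Sum>a\<in>UNIV. \<Sum>b\<in>UNIV.
     ginv g \<kappa> x a b * nabla_form g \<kappa> (\<lambda>c. pderiv_chart \<kappa> c f) a b x)"

section \<open>Conformal classes and densities\<close>

definition rescale :: "('m \<Rightarrow> real) \<Rightarrow> ('m, 'n::finite) tensor2 \<Rightarrow> ('m, 'n) tensor2" where
  "rescale f g = (\<lambda>\<kappa> x. f x *\<^sub>R g \<kappa> x)"

definition conformal_class ::
    "('m, 'n::finite) chart set \<Rightarrow> ('m, 'n) tensor2 set \<Rightarrow> bool" where
  "conformal_class A c \<longleftrightarrow>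
     (\<exists>g. metric A g \<and> c = {rescale f g |f. smooth_fun A f \<and> (\<forall>x. f x > 0)})"

text \<open>
  A density \<open>\<sigma>\<close> is a function of a metric and a point; \<open>\<sigma> g\<close> is its trivialisation in the scale
  \<open>g\<close>. Only metrics in the class \<open>c\<close> are relevant, so \<open>\<sigma>\<close> is required to vanish on the
  others; equality of densities is then equality as functions on \<open>c\<close>. In the scale \<open>g\<close> the
  conformal metric is \<open>g\<close> itself.
\<close>

type_synonym ('m, 'n) density = "('m, 'n) tensor2 \<Rightarrow> 'm \<Rightarrow> real"

definition densities ::
    "('m, 'n::finite) chart set \<Rightarrow> ('m, 'n) tensor2 set \<Rightarrow> real \<Rightarrow> ('m, 'n) density set" where
  "densities A c w = {\<sigma>.
     (\<forall>g\<in>c. smooth_fun A (\<sigma> g)) \<and>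
     (\<forall>g\<in>c. \<forall>\<Omega>. smooth_fun A \<Omega> \<and> (\<forall>x. \<Omega> x > 0) \<longrightarrow>
        (\<forall>x. \<sigma> (rescale (\<lambda>y. (\<Omega> y)\<^sup>2) g) x = \<Omega> x powr w * \<sigma> g x)) \<and>
     (\<forall>g. g \<notin> c \<longrightarrow> \<sigma> g = (\<lambda>x. 0))}"

definition zero_density :: "('m, 'n::finite) density" where
  "zero_density = (\<lambda>g x. 0)"

definition add_density ::
    "('m, 'n::finite) density \<Rightarrow> ('m, 'n) density \<Rightarrow> ('m, 'n) density" where
  "add_density \<sigma> \<tau> = (\<lambda>g x. \<sigma> g x + \<tau> g x)"

definition mult_density ::
    "('m \<Rightarrow> real) \<Rightarrow> ('m, 'n::finite) density \<Rightarrow> ('m, 'n) density" where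
  "mult_density f \<sigma> = (\<lambda>g x. f x * \<sigma> g x)"

section \<open>Jets and tractors\<close>

text \<open>
  The \<open>k\<close>-jet of \<open>\<sigma>\<close> at \<open>x\<close> is the class of all sections of the same weight with the same
  derivatives of order at most \<open>k\<close> at \<open>x\<close>. Global sections suffice as representatives since
  every local section extends after multiplication by a bump function.
\<close>

definition jet ::
    "('m, 'n::finite) chart set \<Rightarrow> ('m, 'n) tensor2 set \<Rightarrow> real \<Rightarrow> nat \<Rightarrow> 'm \<Rightarrow>
       ('m, 'n) density \<Rightarrow> ('m, 'n) density set" where
  "jet A c w k x \<sigma> = {\<tau> \<in> densities A c w.
     \<forall>g\<in>c. \<forall>\<kappa>\<in>A. x \<in> dom_of \<kappa> \<longrightarrow> (\<forall>is. length is \<le> k \<longrightarrow>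
       foldr (pderiv_chart \<kappa>) is (\<tau> g) x = foldr (pderiv_chart \<kappa>) is (\<sigma> g) x)}"

definition jet_vanishes ::
    "('m, 'n::finite) chart set \<Rightarrow> ('m, 'n) tensor2 set \<Rightarrow> real \<Rightarrow> nat \<Rightarrow>
       ('m, 'n) density \<Rightarrow> 'm \<Rightarrow> bool" where
  "jet_vanishes A c w k \<sigma> x \<longleftrightarrow> jet A c w k x \<sigma> = jet A c w k x zero_density"

text \<open>
  The image of \<open>\<E>\<^sub>(\<^sub>a\<^sub>b\<^sub>)\<^sub>0[1]\<close> in the fibre of \<open>J\<^sup>2 \<E>[1]\<close> at \<open>x\<close>: the 2-jets with vanishing
  1-jet, whose second derivatives thus form a symmetric tensor, with this tensor trace-free.
\<close>

definition tracefree_jets ::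
    "('m, 'n::finite) chart set \<Rightarrow> ('m, 'n) tensor2 set \<Rightarrow> 'm \<Rightarrow> ('m, 'n) density set set" where
  "tracefree_jets A c x = {jet A c 1 2 x \<eta> |\<eta>. \<eta> \<in> densities A c 1 \<and> jet_vanishes A c 1 1 \<eta> x \<and>
     (\<forall>g\<in>c. \<forall>\<kappa>\<in>A. x \<in> dom_of \<kappa> \<longrightarrow>
        (\<Sum>a\<in>UNIV. \<Sum>b\<in>UNIV. ginv g \<kappa> x a b *
           pderiv_chart \<kappa> a (pderiv_chart \<kappa> b (\<eta> g)) x) = 0)}"

text \<open>The coset \<open>j + tracefree_jets A c x\<close> of a 2-jet \<open>j\<close>, with sums taken on representatives.\<close>

definition jet_coset ::
    "('m, 'n::finite) chart set \<Rightarrow> ('m, 'n) tensor2 set \<Rightarrow> 'm \<Rightarrow>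
       ('m, 'n) density set \<Rightarrow> ('m, 'n) density set set" where
  "jet_coset A c x j =
     {jet A c 1 2 x (add_density \<tau> \<eta>) |\<tau> \<eta>. \<tau> \<in> j \<and> \<eta> \<in> \<Union> (tracefree_jets A c x)}"

definition tractor_fibre ::
    "('m, 'n::finite) chart set \<Rightarrow> ('m, 'n) tensor2 set \<Rightarrow> 'm \<Rightarrow> ('m, 'n) density set set set" where
  "tractor_fibre A c x = {jet_coset A c x (jet A c 1 2 x \<sigma>) |\<sigma>. \<sigma> \<in> densities A c 1}"

type_synonym ('m, 'n) tractor_field = "'m \<Rightarrow> ('m, 'n) density set set"

text \<open>The operator \<open>(1/n) D\<close>.\<close>

definition tractor_D ::
    "('m, 'n::finite) chart set \<Rightarrow> ('m, 'n) tensor2 set \<Rightarrow> ('m, 'n) density \<Rightarrow>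
       ('m, 'n) tractor_field" where
  "tractor_D A c \<sigma> = (\<lambda>x. jet_coset A c x (jet A c 1 2 x \<sigma>))"

definition zero_tractor ::
    "('m, 'n::finite) chart set \<Rightarrow> ('m, 'n) tensor2 set \<Rightarrow> ('m, 'n) tractor_field" where
  "zero_tractor A c = (\<lambda>x. jet_coset A c x (jet A c 1 2 x zero_density))"

text \<open>
  The splitting in the scale \<open>g\<close>, with Schouten tensor \<open>P\<close>. The three slots depend only on the
  tractor, not on the chosen \<open>\<tau>\<close>; the middle slot has components in the chart \<open>\<kappa>\<close>.
\<close>

definition representative ::
    "('m, 'n::finite) chart set \<Rightarrow> ('m, 'n) tensor2 set \<Rightarrow> 'm \<Rightarrow>
       ('m, 'n) density set set \<Rightarrow> ('m, 'n) density" where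
  "representative A c x t =
     (SOME \<tau>. \<tau> \<in> densities A c 1 \<and> jet_coset A c x (jet A c 1 2 x \<tau>) = t)"

definition top_slot ::
    "('m, 'n::finite) chart set \<Rightarrow> ('m, 'n) tensor2 set \<Rightarrow> ('m, 'n) tensor2 \<Rightarrow>
       ('m, 'n) tractor_field \<Rightarrow> 'm \<Rightarrow> real" where
  "top_slot A c g I x = representative A c x (I x) g x"

definition middle_slot ::
    "('m, 'n::finite) chart set \<Rightarrow> ('m, 'n) tensor2 set \<Rightarrow> ('m, 'n) tensor2 \<Rightarrow> ('m, 'n) chart \<Rightarrow>
       ('m, 'n) tractor_field \<Rightarrow> 'n \<Rightarrow> 'm \<Rightarrow> real" where
  "middle_slot A c g \<kappa> I a x = pderiv_chart \<kappa> a (representative A c x (I x) g) x"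

definition bottom_slot ::
    "('m, 'n::finite) chart set \<Rightarrow> ('m, 'n) tensor2 set \<Rightarrow> ('m, 'n) tensor2 \<Rightarrow> ('m, 'n) tensor2 \<Rightarrow>
       ('m, 'n) chart \<Rightarrow> ('m, 'n) tractor_field \<Rightarrow> 'm \<Rightarrow> real" where
  "bottom_slot A c g P \<kappa> I x = (let \<tau> = representative A c x (I x) g in
     - (1 / real CARD('n)) * (laplacian g \<kappa> \<tau> x + schouten_trace g P \<kappa> x * \<tau> x))"

definition smooth_tractor ::
    "('m, 'n::finite) chart set \<Rightarrow> ('m, 'n) tensor2 set \<Rightarrow> ('m, 'n) tensor2 \<Rightarrow> ('m, 'n) tensor2 \<Rightarrow>
       ('m, 'n) tractor_field \<Rightarrow> bool" where
  "smooth_tractor A c g P I \<longleftrightarrow> (\<forall>x. I x \<in> tractor_fibre A c x) \<and>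
     (\<forall>\<kappa>\<in>A. smooth_in_chart \<kappa> (dom_of \<kappa>) (top_slot A c g I) \<and>
        (\<forall>a. smooth_in_chart \<kappa> (dom_of \<kappa>) (middle_slot A c g \<kappa> I a)) \<and>
        smooth_in_chart \<kappa> (dom_of \<kappa>) (bottom_slot A c g P \<kappa> I))"

text \<open>The slots \<open>\<nabla>\<^sub>a \<sigma> - \<mu>\<^sub>a\<close>, \<open>\<nabla>\<^sub>a \<mu>\<^sub>b + g\<^sub>a\<^sub>b \<rho> + P\<^sub>a\<^sub>b \<sigma>\<close> and \<open>\<nabla>\<^sub>a \<rho> - P\<^sub>a\<^sub>b \<mu>\<^sup>b\<close>.\<close>

definition tractor_connection ::
    "('m, 'n::finite) chart set \<Rightarrow> ('m, 'n) tensor2 set \<Rightarrow> ('m, 'n) tensor2 \<Rightarrow> ('m, 'n) tensor2 \<Rightarrow>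
       ('m, 'n) chart \<Rightarrow> ('m, 'n) tractor_field \<Rightarrow> 'n \<Rightarrow> 'm \<Rightarrow> real \<times> ('n \<Rightarrow> real) \<times> real" where
  "tractor_connection A c g P \<kappa> I a x =
     (let \<sigma> = top_slot A c g I; \<mu> = middle_slot A c g \<kappa> I; \<rho> = bottom_slot A c g P \<kappa> I in
      (pderiv_chart \<kappa> a \<sigma> x - \<mu> a x,
       \<lambda>b. nabla_form g \<kappa> \<mu> a b x + g \<kappa> x $ a $ b * \<rho> x + P \<kappa> x $ a $ b * \<sigma> x,
       pderiv_chart \<kappa> a \<rho> x
         - (\<Sum>b\<in>UNIV. \<Sum>e\<in>UNIV. P \<kappa> x $ a $ b * ginv g \<kappa> x b e * \<mu> e x)))"

text \<open>
  The connection is conformally invariant, so it does not matter in which scale \<open>g\<close> it is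
  computed; \<open>P\<close> is the Schouten tensor of this scale.
\<close>

definition parallel_tractor ::
    "('m, 'n::finite) chart set \<Rightarrow> ('m, 'n) tensor2 set \<Rightarrow> ('m, 'n) tractor_field \<Rightarrow> bool" where
  "parallel_tractor A c I \<longleftrightarrow>
     (\<exists>g\<in>c. \<exists>P. schouten_tensor A g P \<and> smooth_tractor A c g P I \<and>
        (\<forall>\<kappa>\<in>A. \<forall>x\<in>dom_of \<kappa>. \<forall>a. tractor_connection A c g P \<kappa> I a x = (0, \<lambda>b. 0, 0)))"

end

theory Submission
  imports Defs "HOL-Library.Landau_Symbols"
begin

text \<open>
  In a scale \<open>g\<close>, parallelism of \<open>(1/n) D \<sigma>\<close> is a closed homogeneous linear first-order system
  for \<open>(\<sigma>, \<nabla>\<sigma>, \<rho>)\<close>. If the 1-jet of \<open>\<sigma>\<close> and \<open>\<rho>\<close> both vanished at a point, \<open>\<sigma>\<close> would vanish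
  near that point and then, by connectedness, everywhere. So \<open>\<rho> \<noteq> 0\<close> wherever the 1-jet vanishes,
  and there the Hessian of \<open>\<sigma>\<close> is \<open>- \<rho> g\<close>, which is nondegenerate. Nondegenerate critical points
  are isolated, a definite Hessian makes the zero itself isolated, and the Hessian of a product
  \<open>f\<^sub>1 f\<^sub>2 \<tau>\<close> with \<open>f\<^sub>1 x = f\<^sub>2 x = 0\<close> has rank at most \<open>2 < n\<close>.
\<close>

section \<open>Partial derivatives and smooth functions\<close>

text \<open>Two encodings shape the argument. A tractor is a coset of 2-jets, and its slots are read
  from a representative chosen separately at every point; they must be identified with
  \<open>\<sigma>\<close>, its first derivatives and the Laplacian formula before they can be
  differentiated. The bottom slot is one formula per chart, so the set carried through the manifold
  consists of the points near which \<open>\<sigma>\<close> vanishes identically: this condition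
  mentions no chart, and slots are compared with zero only inside a single chart. The analytic input
  is phrased by bounds: each partial derivative of an unknown is O of the sum of the absolute values
  of the unknowns. For the inverse metric and the Christoffel symbols local boundedness therefore
  suffices. All of this takes place in the one scale that \<open>parallel_tractor\<close> supplies;
  positive conformal factors carry nonvanishing to the other scales.\<close>

lemma pd_eq: "(f has_derivative D) (at p) \<Longrightarrow> pd i f p = D (axis i 1)"
  unfolding pd_def using frechet_derivative_at by metis

lemma has_derivative_pd:
  fixes f :: "real^'n \<Rightarrow> real"
  assumes "f differentiable (at p)"
  shows "(f has_derivative (\<lambda>v. \<Sum>i\<in>UNIV. v $ i * pd i f p)) (at p)"
proof -
  let ?D = "frechet_derivative f (at p)"
  have D: "(f has_derivative ?D) (at p)"
    using assms frechet_derivative_works by blast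
  have "?D v = (\<Sum>i\<in>UNIV. v $ i * pd i f p)" for v
  proof -
    interpret linear ?D using D has_derivative_linear by blast
    have "?D v = ?D (\<Sum>i\<in>UNIV. v $ i *s axis i 1)"
      by (simp only: basis_expansion)
    also have "\<dots> = (\<Sum>i\<in>UNIV. v $ i * pd i f p)"
      by (simp add: sum scalar_mult_eq_scaleR scaleR pd_def)
    finally show ?thesis .
  qed
  then have "?D = (\<lambda>v. \<Sum>i\<in>UNIV. v $ i * pd i f p)" by blast
  with D show ?thesis by simp
qed

text \<open>\<open>frechet_derivative\<close> is a choice among all derivatives at the point, and
  equal germs have the same derivatives to choose from. The equality thus holds also where no
  derivative exists.\<close>

lemma pd_cong_eventually:
  assumes "eventually (\<lambda>q. f q = g q) (nhds p)"
  shows "pd i f p = pd i g p"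
proof -
  have fg: "f p = g p" using assms eventually_nhds_x_imp_x by fast
  have "eventually (\<lambda>q. f q = g q) (at p)"
    using assms by (simp add: eventually_nhds_conv_at)
  moreover from this have "eventually (\<lambda>q. g q = f q) (at p)"
    by (rule eventually_mono) simp
  ultimately have "(f has_derivative D) (at p) \<longleftrightarrow> (g has_derivative D) (at p)" for D
    using has_derivative_transform_eventually[of f D p UNIV g]
      has_derivative_transform_eventually[of g D p UNIV f] fg
    by (metis UNIV_I)
  then show ?thesis unfolding pd_def frechet_derivative_def by simp
qed

lemma pd_cong_on:
  assumes "open S" "p \<in> S" "\<And>q. q \<in> S \<Longrightarrow> f q = g q"
  shows "pd i f p = pd i g p"
  using assms by (intro pd_cong_eventually) (auto simp: eventually_nhds)

lemma pd_const [simp]: "pd i (\<lambda>q. c) p = 0"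
  using pd_eq[OF has_derivative_const] .

lemma sum_axis: "(\<Sum>k\<in>UNIV. axis i (1::real) $ k * a k) = a i"
proof -
  have "(\<Sum>k\<in>UNIV. axis i (1::real) $ k * a k) = (\<Sum>k\<in>UNIV. if k = i then a k else 0)"
    by (intro sum.cong) (auto simp: axis_def)
  then show ?thesis by simp
qed

lemma pd_add:
  fixes f g :: "real^'n \<Rightarrow> real"
  assumes "f differentiable (at p)" "g differentiable (at p)"
  shows "pd i (\<lambda>q. f q + g q) p = pd i f p + pd i g p"
  unfolding pd_eq[OF has_derivative_add[OF assms[THEN has_derivative_pd]]] sum_axis ..

lemma pd_mult:
  fixes f g :: "real^'n \<Rightarrow> real"
  assumes "f differentiable (at p)" "g differentiable (at p)"
  shows "pd i (\<lambda>q. f q * g q) p = f p * pd i g p + pd i f p * g p"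
  unfolding pd_eq[OF has_derivative_mult[OF assms[THEN has_derivative_pd]]] sum_axis ..

text \<open>Only products, a constant factor and \<open>inverse\<close> occur on the right, so that
  the closure rules for \<open>Ck_on\<close> apply to it verbatim; \<open>pd_sqrt\<close> has its
  form for the same reason.\<close>

lemma pd_inverse:
  fixes f :: "real^'n \<Rightarrow> real"
  assumes "f differentiable (at p)" "f p \<noteq> 0"
  shows "pd i (\<lambda>q. inverse (f q)) p = (- 1) * (pd i f p * (inverse (f p) * inverse (f p)))"
  unfolding pd_eq[OF Deriv.has_derivative_inverse[OF assms(2) has_derivative_pd[OF assms(1)]]] sum_axis
  by (simp only: mult_ac mult_minus1)

lemma pd_sqrt:
  fixes f :: "real^'n \<Rightarrow> real"
  assumes "f differentiable (at p)" "f p > 0"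
  shows "(\<lambda>q. sqrt (f q)) differentiable (at p)"
    and "pd i (\<lambda>q. sqrt (f q)) p = (1/2) * (pd i f p * inverse (sqrt (f p)))"
proof -
  note D = has_derivative_real_sqrt[OF assms(2) has_derivative_pd[OF assms(1)]]
  then show "(\<lambda>q. sqrt (f q)) differentiable (at p)" unfolding differentiable_def by blast
  show "pd i (\<lambda>q. sqrt (f q)) p = (1/2) * (pd i f p * inverse (sqrt (f p)))"
    unfolding pd_eq[OF D] sum_axis by simp
qed

section \<open>Closure properties of the differentiability classes\<close>

text \<open>The rules for derivatives give equalities only at points of \<open>S\<close>, so
  membership in a class has to be transferred along equality on \<open>S\<close>. Openness makes the
  partial derivatives agree on \<open>S\<close> as well, which drives the induction.\<close>

lemma Ck_on_cong:
  assumes "open S" "Ck_on k S g" "\<And>q. q \<in> S \<Longrightarrow> f q = g q"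
  shows "Ck_on k S f"
  using assms(2,3)
proof (induction k arbitrary: f g)
  case 0
  then show ?case by (simp cong: continuous_on_cong)
next
  case (Suc k)
  have "f differentiable_on S"
    using Suc.prems by (auto intro: differentiable_transform_within[OF _ zero_less_one]
        simp: differentiable_on_def)
  moreover have "Ck_on k S (pd i f)" for i
  proof (rule Suc.IH)
    show "Ck_on k S (pd i g)" using Suc.prems(1) by simp
    show "pd i f q = pd i g q" if "q \<in> S" for q
      using pd_cong_on[OF assms(1) that Suc.prems(2)] .
  qed
  ultimately show ?case by simp
qed

lemma Ck_on_Suc_imp: "Ck_on (Suc k) S f \<Longrightarrow> Ck_on k S f"
proof (induction k arbitrary: f)
  case 0
  then show ?case by (simp add: differentiable_imp_continuous_on)
qed simp

lemma Ck_on_differentiable_at: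
  "Ck_on (Suc k) S f \<Longrightarrow> open S \<Longrightarrow> p \<in> S \<Longrightarrow> f differentiable (at p)"
  by (simp add: differentiable_on_eq_differentiable_at)

lemma Ck_on_const: "Ck_on k (S :: (real^'n) set) (\<lambda>q. c)"
proof (induction k arbitrary: c)
  case (Suc k)
  have "pd i (\<lambda>q::real^'n. c) = (\<lambda>q. 0)" for i by (rule ext) simp
  then have "Ck_on k S (pd i (\<lambda>q. c))" for i
    using Suc.IH[of 0] by metis
  then show ?case by simp
qed simp

lemma Ck_on_add:
  assumes "open S"
  shows "Ck_on k S f \<Longrightarrow> Ck_on k S g \<Longrightarrow> Ck_on k S (\<lambda>q. f q + g q)"
proof (induction k arbitrary: f g)
  case 0
  then show ?case by (simp add: continuous_on_add)
next
  case (Suc k)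
  have "Ck_on k S (pd i (\<lambda>q. f q + g q))" for i
  proof (rule Ck_on_cong[OF assms _ pd_add])
    show "Ck_on k S (\<lambda>q. pd i f q + pd i g q)"
      using Suc by simp
  qed (use Suc.prems Ck_on_differentiable_at assms in blast)+
  then show ?case using Suc.prems by (simp add: differentiable_on_add)
qed

lemma Ck_on_mult:
  assumes "open S"
  shows "Ck_on k S f \<Longrightarrow> Ck_on k S g \<Longrightarrow> Ck_on k S (\<lambda>q. f q * g q)"
proof (induction k arbitrary: f g)
  case 0
  then show ?case by (simp add: continuous_on_mult)
next
  case (Suc k)
  have "Ck_on k S (pd i (\<lambda>q. f q * g q))" for i
  proof (rule Ck_on_cong[OF assms _ pd_mult])
    show "Ck_on k S (\<lambda>q. f q * pd i g q + pd i f q * g q)"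
      using Suc.prems Ck_on_Suc_imp[OF Suc.prems(1)] Ck_on_Suc_imp[OF Suc.prems(2)]
      by (intro Ck_on_add assms Suc.IH) auto
  qed (use Suc.prems Ck_on_differentiable_at assms in blast)+
  then show ?case using Suc.prems by (simp add: differentiable_on_mult)
qed

text \<open>The derivative of the inverse contains the inverse again, but only its class one order
  lower is asked for, and that is the induction hypothesis.\<close>

lemma Ck_on_inverse:
  fixes f :: "real^'n \<Rightarrow> real"
  assumes "open S" "\<And>q. q \<in> S \<Longrightarrow> f q \<noteq> 0"
  shows "Ck_on k S f \<Longrightarrow> Ck_on k S (\<lambda>q. inverse (f q))"
proof (induction k)
  case 0
  then show ?case using assms(2) continuous_on_inverse by (metis Ck_on.simps(1))
next
  case (Suc k)
  note IH = Suc.IH[OF Ck_on_Suc_imp[OF Suc.prems]]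
  have "Ck_on k S (pd i (\<lambda>q. inverse (f q)))" for i
  proof (rule Ck_on_cong[OF assms(1) _ pd_inverse])
    show "Ck_on k S (\<lambda>q. (- 1) * (pd i f q * (inverse (f q) * inverse (f q))))"
      by (rule Ck_on_mult Ck_on_const assms(1) IH | use Suc.prems in simp)+
  qed (use Suc.prems Ck_on_differentiable_at assms in blast)+
  moreover have "(\<lambda>q. inverse (f q)) differentiable_on S"
    using Suc.prems assms(2) by (intro differentiable_on_inverse) auto
  ultimately show ?case by simp
qed

text \<open>Needed for the conformal factor between two metrics of a class: densities scale by
  powers of \<Omega>, while the metric scales by the square of \<Omega>.\<close>

lemma Ck_on_sqrt:
  fixes f :: "real^'n \<Rightarrow> real"
  assumes "open S" "\<And>q. q \<in> S \<Longrightarrow> f q > 0"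
  shows "Ck_on k S f \<Longrightarrow> Ck_on k S (\<lambda>q. sqrt (f q))"
proof (induction k)
  case 0
  then show ?case by (simp add: continuous_on_real_sqrt)
next
  case (Suc k)
  note IH = Suc.IH[OF Ck_on_Suc_imp[OF Suc.prems]]
  note df = Ck_on_differentiable_at[OF Suc.prems assms(1)]
  have nz: "sqrt (f q) \<noteq> 0" if "q \<in> S" for q
    using assms(2)[OF that] by simp
  have "Ck_on k S (pd i (\<lambda>q. sqrt (f q)))" for i
  proof (rule Ck_on_cong[OF assms(1) _ pd_sqrt(2)[OF df assms(2)]])
    show "Ck_on k S (\<lambda>q. (1/2) * (pd i f q * inverse (sqrt (f q))))"
      by (rule Ck_on_mult Ck_on_const Ck_on_inverse assms(1) IH nz | assumption | use Suc.prems in simp)+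
  qed
  moreover have "(\<lambda>q. sqrt (f q)) differentiable_on S"
    using pd_sqrt(1)[OF df assms(2)] differentiable_at_imp_differentiable_on by blast
  ultimately show ?case by simp
qed

lemma smooth_on_mult:
  "open S \<Longrightarrow> smooth_on S f \<Longrightarrow> smooth_on S g \<Longrightarrow> smooth_on S (\<lambda>q. f q * g q)"
  unfolding smooth_on_def using Ck_on_mult by blast

lemma smooth_on_differentiable_at:
  "smooth_on S f \<Longrightarrow> open S \<Longrightarrow> p \<in> S \<Longrightarrow> f differentiable (at p)"
  unfolding smooth_on_def using Ck_on_differentiable_at by blast

lemma smooth_on_pd: "smooth_on S f \<Longrightarrow> smooth_on S (pd i f)"
  unfolding smooth_on_def by (metis Ck_on.simps(2))

lemma smooth_on_isCont: "smooth_on S f \<Longrightarrow> open S \<Longrightarrow> p \<in> S \<Longrightarrow> isCont f p"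
  using smooth_on_differentiable_at differentiable_imp_continuous_within by blast

section \<open>Homogeneous linear first-order systems\<close>

text \<open>The filter is \<open>nhds p\<close>, not \<open>at p\<close>, so the bounds hold at the
  centre of the ball too, as the supremum argument over a closed ball requires.\<close>

lemma isCont_bigo_1:
  fixes f :: "'a::t2_space \<Rightarrow> real"
  assumes "isCont f p"
  shows "f \<in> O[nhds p](\<lambda>_. 1)"
proof (rule bigoI_tendsto)
  show "((\<lambda>x. f x / 1) \<longlongrightarrow> f p) (nhds p)"
    using assms by (simp add: continuous_within tendsto_at_iff_tendsto_nhds)
qed simp

lemma bigo_1_mult:
  assumes "a \<in> O[F](\<lambda>_. 1)" "u \<in> O[F](g)"
  shows "(\<lambda>x. a x * u x) \<in> O[F](g)"
  using landau_o.big.mult[OF assms] by simp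

text \<open>On a small ball, the mean value theorem bounds the supremum of the solution by a proper
  fraction of itself.\<close>

lemma linear_system_vanishing:
  fixes u :: "'j::finite \<Rightarrow> real^'n \<Rightarrow> real"
  assumes diff: "\<And>j. eventually (\<lambda>p. u j differentiable (at p)) (nhds p0)"
    and bound: "\<And>i j. pd i (u j) \<in> O[nhds p0](\<lambda>p. \<Sum>k\<in>UNIV. \<bar>u k p\<bar>)"
    and init: "\<And>j. u j p0 = 0"
  shows "eventually (\<lambda>p. \<forall>j. u j p = 0) (nhds p0)"
proof -
  define s where "s p = (\<Sum>k\<in>UNIV. \<bar>u k p\<bar>)" for p
  have s0: "s p \<ge> 0" for p unfolding s_def by (simp add: sum_nonneg)
  have "\<exists>K. eventually (\<lambda>p. \<bar>pd i (u j) p\<bar> \<le> K * s p) (nhds p0)" for i j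
  proof -
    obtain K where "eventually (\<lambda>p. norm (pd i (u j) p) \<le> K * norm (s p)) (nhds p0)"
      using landau_o.bigE[OF bound[of i j, folded s_def]] by blast
    then show ?thesis using s0 by auto
  qed
  then obtain K where K: "\<And>i j. eventually (\<lambda>p. \<bar>pd i (u j) p\<bar> \<le> K i j * s p) (nhds p0)"
    by metis
  have "eventually (\<lambda>p. (\<forall>j. u j differentiable (at p)) \<and>
      (\<forall>i j. \<bar>pd i (u j) p\<bar> \<le> K i j * s p)) (nhds p0)"
    using diff K by (intro eventually_conj eventually_all_finite) auto
  then obtain e where e: "e > 0" and
    de: "\<And>p j. dist p p0 < e \<Longrightarrow> u j differentiable (at p)" and
    be: "\<And>p i j. dist p p0 < e \<Longrightarrow> \<bar>pd i (u j) p\<bar> \<le> K i j * s p"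
    unfolding eventually_nhds_metric by blast
  \<comment> \<open>A sum of absolute values dominates all the constants \<open>K i j\<close> at
    once.\<close>
  define C where "C = (\<Sum>j\<in>UNIV. \<Sum>i\<in>UNIV. \<bar>K i j\<bar>)"
  have C0: "C \<ge> 0" unfolding C_def by (simp add: sum_nonneg)
  \<comment> \<open>The bound \<open>e / 2\<close> keeps the closed ball inside the region where the
    estimates hold; the other bound gives \<open>C * r \<le> C / (2 * (C + 1)) < 1\<close>. The
    summand 1 keeps the denominator positive when \<open>C = 0\<close>.\<close>
  define r where "r = min (e / 2) (1 / (2 * (C + 1)))"
  have r: "r > 0" "r < e" "C * r < 1"
  proof -
    show "r > 0" "r < e" using e C0 by (auto simp: r_def min_def)
    have "C * r \<le> C * (1 / (2 * (C + 1)))"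
      unfolding r_def by (intro mult_left_mono C0) simp
    also have "\<dots> < 1" using C0 by (simp add: field_simps)
    finally show "C * r < 1" .
  qed
  have in_e: "dist p p0 < e" if "p \<in> cball p0 r" for p
    using that r by (simp add: dist_commute)
  have "continuous_on (cball p0 r) (u j)" for j
    using de in_e by (meson continuous_at_imp_continuous_on differentiable_imp_continuous_within)
  then have "continuous_on (cball p0 r) s"
    unfolding s_def by (intro continuous_intros)
  \<comment> \<open>At a maximum point \<open>q\<close> of \<open>s\<close>, all partial derivatives
    on the ball are controlled by \<open>s q\<close>, and the mean value theorem then bounds the
    unknowns at \<open>q\<close> itself.\<close>
  then obtain q where q: "q \<in> cball p0 r" "\<And>p. p \<in> cball p0 r \<Longrightarrow> s p \<le> s q"
    using continuous_attains_sup[of "cball p0 r" s] r by auto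
  have u_le: "\<bar>u j q\<bar> \<le> (\<Sum>i\<in>UNIV. \<bar>K i j\<bar>) * s q * r" for j
  proof -
    have "norm (u j q - u j p0) \<le> ((\<Sum>i\<in>UNIV. \<bar>K i j\<bar>) * s q) * norm (q - p0)"
    proof (rule differentiable_bound)
      show "convex (cball p0 r)" "q \<in> cball p0 r" "p0 \<in> cball p0 r"
        using q r by auto
      fix p assume p: "p \<in> cball p0 r"
      show "(u j has_derivative (\<lambda>v. \<Sum>i\<in>UNIV. v $ i * pd i (u j) p)) (at p within cball p0 r)"
        using has_derivative_pd[OF de[OF in_e[OF p]]] has_derivative_at_withinI by blast
      show "onorm (\<lambda>v. \<Sum>i\<in>UNIV. v $ i * pd i (u j) p) \<le> (\<Sum>i\<in>UNIV. \<bar>K i j\<bar>) * s q"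
      proof (rule onorm_le)
        fix v :: "real^'n"
        have "norm (\<Sum>i\<in>UNIV. v $ i * pd i (u j) p) \<le> (\<Sum>i\<in>UNIV. \<bar>v $ i\<bar> * \<bar>pd i (u j) p\<bar>)"
          unfolding real_norm_def by (rule order_trans[OF sum_abs]) (simp add: abs_mult)
        also have "\<dots> \<le> (\<Sum>i\<in>UNIV. norm v * (\<bar>K i j\<bar> * s q))"
        proof (intro sum_mono mult_mono component_le_norm_cart)
          fix i
          have "\<bar>pd i (u j) p\<bar> \<le> K i j * s p" using be[OF in_e[OF p]] .
          also have "\<dots> \<le> \<bar>K i j\<bar> * s q"
            using s0 q(2)[OF p] by (intro mult_mono) auto
          finally show "\<bar>pd i (u j) p\<bar> \<le> \<bar>K i j\<bar> * s q" .
        qed auto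
        also have "\<dots> = (\<Sum>i\<in>UNIV. \<bar>K i j\<bar>) * s q * norm v"
          by (simp add: sum_distrib_left sum_distrib_right mult_ac)
        finally show "norm (\<Sum>i\<in>UNIV. v $ i * pd i (u j) p) \<le> (\<Sum>i\<in>UNIV. \<bar>K i j\<bar>) * s q * norm v" .
      qed
    qed
    also have "\<dots> \<le> ((\<Sum>i\<in>UNIV. \<bar>K i j\<bar>) * s q) * r"
      using q(1) s0 by (intro mult_left_mono mult_nonneg_nonneg sum_nonneg)
        (auto simp: dist_norm norm_minus_commute)
    finally show ?thesis using init by simp
  qed
  have "s q \<le> (\<Sum>j\<in>UNIV. (\<Sum>i\<in>UNIV. \<bar>K i j\<bar>) * s q * r)"
    unfolding s_def[of q] by (intro sum_mono) (use u_le[unfolded s_def] in blast)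
  also have "\<dots> = C * s q * r" unfolding C_def by (simp only: sum_distrib_right)
  finally have "(1 - C * r) * s q \<le> 0" by (simp add: algebra_simps)
  then have "s q \<le> 0" using r(3) by (simp add: mult_le_0_iff)
  then have "s p = 0" if "p \<in> cball p0 r" for p
    using q(2)[OF that] s0[of p] by linarith
  then have "u j p = 0" if "p \<in> cball p0 r" for p j
    using that unfolding s_def by (simp add: sum_nonneg_eq_0_iff)
  then show ?thesis
    unfolding eventually_nhds_metric using r(1)
    by (metis dist_commute less_imp_le mem_cball)
qed

section \<open>Bounded coefficients and the tractor system\<close>

lemma matrix_mult_matrix_inv:
  assumes "invertible M"
  shows "M ** matrix_inv M = mat 1"
  using someI_ex[OF assms[unfolded invertible_def]] unfolding matrix_inv_def by blast

text \<open>The invertible \<open>G p\<close> satisfies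
  \<open>norm (G p *v v) \<ge> B * norm v\<close>. Near \<open>p\<close> the perturbation has
  operator norm below \<open>B / 2\<close>, so \<open>G x\<close> still has lower bound
  \<open>B / 2\<close>, and every column of its inverse has norm at most
  \<open>2 / B\<close>.\<close>

lemma matrix_inv_bigo_1:
  fixes G :: "'a::t2_space \<Rightarrow> real^'n^'n"
  assumes cont: "\<And>i j. isCont (\<lambda>x. G x $ i $ j) p"
    and inv: "eventually (\<lambda>x. invertible (G x)) (nhds p)"
  shows "(\<lambda>x. matrix_inv (G x) $ i $ j) \<in> O[nhds p](\<lambda>_. 1)"
proof -
  have "invertible (G p)" using inv eventually_nhds_x_imp_x by fast
  then obtain B where B: "B > 0" "\<And>v. B * norm v \<le> norm (G p *v v)"
    using linear_inj_bounded_below_pos[OF matrix_vector_mul_linear inj_matrix_vector_mult] by blast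
  \<comment> \<open>The entrywise sum dominates the operator norm and is visibly continuous in
    \<open>x\<close>.\<close>
  define d where "d x = (\<Sum>k\<in>UNIV. \<Sum>l\<in>UNIV. \<bar>(G x - G p) $ k $ l\<bar>)" for x
  have "isCont d p" unfolding d_def using cont
    by (auto intro!: continuous_intros)
  moreover have "d p = 0" unfolding d_def by simp
  ultimately have "(d \<longlongrightarrow> 0) (nhds p)"
    by (metis isCont_def tendsto_at_iff_tendsto_nhds)
  then have "eventually (\<lambda>x. d x < B / 2) (nhds p)"
    using B(1) order_tendstoD(2) half_gt_zero by blast
  with inv have "eventually (\<lambda>x. norm (matrix_inv (G x) $ i $ j) \<le> (2 / B) * norm (1::real)) (nhds p)"
  proof eventually_elim
    case (elim x)
    \<comment> \<open>This is column \<open>j\<close> of the inverse, the preimage of a unit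
      vector.\<close>
    define v where "v = matrix_inv (G x) *v axis j 1"
    have Gv: "G x *v v = axis j 1"
      unfolding v_def using elim(1) by (simp add: matrix_vector_mul_assoc matrix_mult_matrix_inv)
    have "norm ((G x - G p) *v v) \<le> onorm ((*v) (G x - G p)) * norm v"
      by (rule onorm) (rule matrix_vector_mul_bounded_linear)
    also have "\<dots> \<le> d x * norm v"
      unfolding d_def by (intro mult_right_mono onorm_le_matrix_component_sum) simp
    also have "\<dots> \<le> B / 2 * norm v" using elim(2) by (intro mult_right_mono) auto
    finally have "norm (G p *v v) - norm (G x *v v) \<le> B / 2 * norm v"
      using norm_triangle_ineq2[of "G p *v v" "G x *v v"]
      by (simp add: matrix_vector_mult_diff_rdistrib norm_minus_commute)
    then have "B * norm v \<le> 1 + B / 2 * norm v" using B(2)[of v] Gv by simp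
    then have "norm v \<le> 2 / B" using B(1) by (simp add: field_simps)
    moreover have "matrix_inv (G x) $ i $ j = v $ i"
      unfolding v_def by (simp add: matrix_vector_mult_basis column_def)
    ultimately show ?case using component_le_norm_cart[of v i] by simp
  qed
  then show ?thesis by (rule bigoI)
qed

text \<open>The equations write every partial derivative of \<open>F\<close>, of its first
  derivatives and of \<open>\<rho>\<close> as bounded coefficients times these same functions. The
  geometry enters through local bounds alone: \<open>\<Gamma>\<close> stands for Christoffel
  symbols, \<open>Gi\<close> for the inverse metric.\<close>

lemma tractor_system_vanishing:
  fixes F \<rho> :: "real^'n \<Rightarrow> real"
  assumes S: "open S" "p0 \<in> S"
    and dF: "\<And>p. p \<in> S \<Longrightarrow> F differentiable (at p)"
    and dG: "\<And>p b. p \<in> S \<Longrightarrow> pd b F differentiable (at p)"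
    and dr: "\<And>p. p \<in> S \<Longrightarrow> \<rho> differentiable (at p)"
    and eq1: "\<And>p a b. p \<in> S \<Longrightarrow> pd a (pd b F) p =
      (\<Sum>e\<in>UNIV. \<Gamma> e a b p * pd e F p) - G a b p * \<rho> p - P a b p * F p"
    and eq2: "\<And>p a. p \<in> S \<Longrightarrow> pd a \<rho> p =
      (\<Sum>b\<in>UNIV. \<Sum>e\<in>UNIV. P a b p * Gi b e p * pd e F p)"
    and bnd: "\<And>e a b. \<Gamma> e a b \<in> O[nhds p0](\<lambda>_. 1)" "\<And>a b. G a b \<in> O[nhds p0](\<lambda>_. 1)"
      "\<And>a b. P a b \<in> O[nhds p0](\<lambda>_. 1)" "\<And>a b. Gi a b \<in> O[nhds p0](\<lambda>_. 1)"
    and init: "F p0 = 0" "\<And>b. pd b F p0 = 0" "\<rho> p0 = 0"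
  shows "eventually (\<lambda>p. F p = 0) (nhds p0)"
proof -
  \<comment> \<open>The index type has n + 2 elements: \<open>None\<close> for \<open>F\<close>,
    \<open>Some None\<close> for \<open>\<rho>\<close>, and one for each partial derivative of
    \<open>F\<close>.\<close>
  define u :: "'n option option \<Rightarrow> real^'n \<Rightarrow> real" where
    "u j = (case j of None \<Rightarrow> F | Some None \<Rightarrow> \<rho> | Some (Some b) \<Rightarrow> pd b F)" for j
  define s where "s = (\<lambda>p. \<Sum>k\<in>UNIV. \<bar>u k p\<bar>)"
  have evS: "eventually (\<lambda>p. p \<in> S) (nhds p0)"
    using S by (rule eventually_nhds_in_open)
  have u_s: "u j \<in> O[nhds p0](s)" for j
    by (rule bigoI[of _ 1]) (auto simp: s_def intro!: always_eventually member_le_sum)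
  have Fs: "F \<in> O[nhds p0](s)" and Gs: "pd b F \<in> O[nhds p0](s)" and rs: "\<rho> \<in> O[nhds p0](s)" for b
    using u_s[of None] u_s[of "Some (Some b)"] u_s[of "Some None"] by (simp_all add: u_def)
  have GGs: "pd a (pd b F) \<in> O[nhds p0](s)" for a b
  proof (subst landau_o.big.in_cong)
    show "eventually (\<lambda>p. pd a (pd b F) p =
        (\<Sum>e\<in>UNIV. \<Gamma> e a b p * pd e F p) - G a b p * \<rho> p - P a b p * F p) (nhds p0)"
      using evS by eventually_elim (rule eq1)
    show "(\<lambda>p. (\<Sum>e\<in>UNIV. \<Gamma> e a b p * pd e F p) - G a b p * \<rho> p - P a b p * F p)
        \<in> O[nhds p0](s)"
      by (intro sum_in_bigo big_sum_in_bigo bigo_1_mult bnd Fs Gs rs)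
  qed
  have Grs: "pd a \<rho> \<in> O[nhds p0](s)" for a
  proof (subst landau_o.big.in_cong)
    show "eventually (\<lambda>p. pd a \<rho> p =
        (\<Sum>b\<in>UNIV. \<Sum>e\<in>UNIV. P a b p * Gi b e p * pd e F p)) (nhds p0)"
      using evS by eventually_elim (rule eq2)
    show "(\<lambda>p. \<Sum>b\<in>UNIV. \<Sum>e\<in>UNIV. P a b p * Gi b e p * pd e F p) \<in> O[nhds p0](s)"
      unfolding mult.assoc by (intro big_sum_in_bigo bigo_1_mult bnd Gs)
  qed
  have "eventually (\<lambda>p. \<forall>j. u j p = 0) (nhds p0)"
  proof (rule linear_system_vanishing)
    show "eventually (\<lambda>p. u j differentiable (at p)) (nhds p0)" for j
      using evS by eventually_elim (auto simp: u_def dF dG dr split: option.split)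
    show "pd i (u j) \<in> O[nhds p0](\<lambda>p. \<Sum>k\<in>UNIV. \<bar>u k p\<bar>)" for i j
      unfolding s_def[symmetric] using Gs GGs Grs by (auto simp: u_def split: option.split)
    show "u j p0 = 0" for j using init by (auto simp: u_def split: option.split)
  qed
  then show ?thesis
  proof eventually_elim
    case (elim p)
    from spec[OF this, of None] show ?case by (simp add: u_def)
  qed
qed

section \<open>Critical points\<close>

definition hessian :: "(real^'n::finite \<Rightarrow> real) \<Rightarrow> real^'n \<Rightarrow> real^'n^'n" where
  "hessian F p = (\<chi> a b. pd a (pd b F) p)"

definition grad :: "(real^'n::finite \<Rightarrow> real) \<Rightarrow> real^'n \<Rightarrow> real^'n" where
  "grad F p = (\<chi> b. pd b F p)"

text \<open>Component \<open>b\<close> is differentiated by summing over the outer derivative, which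
  is the row index of \<open>hessian\<close>; hence the vector multiplies from the left.\<close>

lemma has_derivative_grad:
  assumes "\<And>b. pd b F differentiable (at p)"
  shows "(grad F has_derivative (\<lambda>v. v v* hessian F p)) (at p)"
proof -
  have "((\<lambda>q. grad F q \<bullet> axis b 1) has_derivative (\<lambda>v. (v v* hessian F p) \<bullet> axis b 1)) (at p)" for b
  proof -
    have "(\<lambda>q. grad F q \<bullet> axis b 1) = pd b F"
      by (auto simp: grad_def inner_axis)
    moreover have "(v v* hessian F p) \<bullet> axis b 1 = (\<Sum>a\<in>UNIV. v $ a * pd a (pd b F) p)" for v
      by (simp add: inner_axis vector_matrix_mult_def hessian_def mult.commute)
    ultimately show ?thesis using has_derivative_pd[OF assms[of b]] by simp
  qed
  then show ?thesis
    by (subst has_derivative_componentwise_within) (auto simp: Basis_vec_def)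
qed

text \<open>Injectivity bounds the linear part of \<open>grad F\<close> below by
  \<open>B * norm v\<close>. Close to \<open>p0\<close> the remainder is at most half of that and
  cannot cancel it.\<close>

lemma nondegenerate_critical_point_isolated:
  fixes F :: "real^'n \<Rightarrow> real"
  assumes diff: "\<And>b. pd b F differentiable (at p0)" and crit: "grad F p0 = 0"
    and nondeg: "\<And>v. v v* hessian F p0 = 0 \<Longrightarrow> v = 0"
  shows "eventually (\<lambda>p. grad F p \<noteq> 0) (at p0)"
proof -
  let ?D = "\<lambda>v. v v* hessian F p0"
  have D: "(grad F has_derivative ?D) (at p0)" by (rule has_derivative_grad[OF diff])
  then have lin: "linear ?D" by (rule has_derivative_linear)
  have "inj ?D" using nondeg linear_injective_0[OF lin] by blast
  then obtain B where B: "B > 0" "\<And>v. B * norm v \<le> norm (?D v)"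
    using linear_inj_bounded_below_pos[OF lin] by blast
  then obtain d where d: "d > 0"
    "\<And>q. norm (q - p0) < d \<Longrightarrow> norm (grad F q - grad F p0 - ?D (q - p0)) \<le> B / 2 * norm (q - p0)"
    using D unfolding has_derivative_at_alt by (meson half_gt_zero)
  show ?thesis unfolding eventually_at
  proof (intro exI conjI ballI impI)
    show "d > 0" by (rule d)
    fix q assume q: "q \<noteq> p0 \<and> dist q p0 < d"
    show "grad F q \<noteq> 0"
    proof
      assume "grad F q = 0"
      then have "norm (?D (q - p0)) \<le> B / 2 * norm (q - p0)"
        using d(2)[of q] q crit by (simp add: dist_norm)
      with B(2)[of "q - p0"] have "B / 2 * norm (q - p0) \<le> 0" by simp
      then show False using B(1) q by (simp add: mult_le_0_iff)
    qed
  qed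
qed

text \<open>By the mean value theorem \<open>F p = grad F q \<bullet> (p - p0)\<close> for some \<open>q = p0 + s (p - p0)\<close>, which
  is \<open>s\<close> times the Hessian form at \<open>p - p0\<close> up to \<open>o(s |p - p0|\<^sup>2)\<close>.\<close>

lemma anisotropic_critical_point_isolated_zero:
  fixes F :: "real^'n \<Rightarrow> real"
  assumes dF: "eventually (\<lambda>p. F differentiable (at p)) (nhds p0)"
    and diff: "\<And>b. pd b F differentiable (at p0)" and crit: "F p0 = 0" "grad F p0 = 0"
    and anis: "\<And>v. v \<noteq> 0 \<Longrightarrow> (v v* hessian F p0) \<bullet> v \<noteq> 0"
  shows "eventually (\<lambda>p. F p \<noteq> 0) (at p0)"
proof -
  let ?D = "\<lambda>v. v v* hessian F p0"
  have D: "(grad F has_derivative ?D) (at p0)" by (rule has_derivative_grad[OF diff])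
  then have lin: "linear ?D" by (rule has_derivative_linear)
  \<comment> \<open>Compactness turns the pointwise hypothesis \<open>anis\<close> into a uniform
    bound: the minimum over the unit sphere is attained, hence positive. The absolute value treats
    both signs of the form at once; \<open>axis undefined 1\<close> only shows that the sphere is
    nonempty.\<close>
  have "continuous_on (sphere 0 1) (\<lambda>v. \<bar>?D v \<bullet> v\<bar>)"
    using D by (intro continuous_intros linear_continuous_on has_derivative_bounded_linear)
  moreover have "axis undefined 1 \<in> sphere (0::real^'n) 1" by simp
  ultimately obtain w where w: "w \<in> sphere 0 1"
    "\<And>v. v \<in> sphere 0 1 \<Longrightarrow> \<bar>?D w \<bullet> w\<bar> \<le> \<bar>?D v \<bullet> v\<bar>"
    using continuous_attains_inf[of "sphere (0::real^'n) 1" "\<lambda>v. \<bar>?D v \<bullet> v\<bar>"] by auto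
  define B where "B = \<bar>?D w \<bullet> w\<bar>"
  have "w \<noteq> 0" using w(1) by auto
  then have B: "B > 0" unfolding B_def using anis by simp
  have low: "B * (norm v)\<^sup>2 \<le> \<bar>?D v \<bullet> v\<bar>" for v
  proof (cases "v = 0")
    case False
    let ?u = "(1 / norm v) *\<^sub>R v"
    have "B \<le> \<bar>?D ?u \<bullet> ?u\<bar>" unfolding B_def using w(2)[of ?u] False by simp
    also have "\<dots> = \<bar>?D v \<bullet> v\<bar> / (norm v)\<^sup>2"
      unfolding linear_scale[OF lin] by (simp add: abs_mult power2_eq_square)
    finally show ?thesis using False by (simp add: field_simps)
  qed simp
  obtain d where d: "d > 0"
    "\<And>q. norm (q - p0) < d \<Longrightarrow> norm (grad F q - grad F p0 - ?D (q - p0)) \<le> B / 2 * norm (q - p0)"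
    using D B unfolding has_derivative_at_alt by (meson half_gt_zero)
  obtain d' where d': "d' > 0" "\<And>q. dist q p0 < d' \<Longrightarrow> F differentiable (at q)"
    using dF unfolding eventually_nhds_metric by blast
  show ?thesis unfolding eventually_at
  proof (intro exI conjI ballI impI)
    show "min d d' > 0" using d d' by simp
    fix p assume p: "p \<noteq> p0 \<and> dist p p0 < min d d'"
    define v where "v = p - p0"
    define \<gamma> where "\<gamma> s = p0 + s *\<^sub>R v" for s :: real
    have v: "v \<noteq> 0" "norm v < d" "norm v < d'" using p by (auto simp: v_def dist_norm)
    have dist: "dist (\<gamma> s) p0 \<le> norm v" if "0 \<le> s" "s \<le> 1" for s
      using that by (simp add: \<gamma>_def dist_norm mult_left_le_one_le)
    have "((\<lambda>s. F (\<gamma> s)) has_derivative (\<lambda>h. h * (grad F (\<gamma> s) \<bullet> v))) (at s within {0..1})"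
      if s: "0 \<le> s" "s \<le> 1" for s
    proof -
      have "F differentiable (at (\<gamma> s))" using d'(2) dist[OF s] v(3) by simp
      then have "(F has_derivative (\<lambda>w. \<Sum>i\<in>UNIV. w $ i * pd i F (\<gamma> s))) (at (\<gamma> s))"
        by (rule has_derivative_pd)
      moreover have "(\<gamma> has_derivative (\<lambda>h. h *\<^sub>R v)) (at s within {0..1})"
        unfolding \<gamma>_def by (auto intro!: derivative_eq_intros)
      ultimately have "((\<lambda>s. F (\<gamma> s)) has_derivative
          (\<lambda>h. \<Sum>i\<in>UNIV. (h *\<^sub>R v) $ i * pd i F (\<gamma> s))) (at s within {0..1})"
        by (rule has_derivative_compose[rotated])
      moreover have "(\<Sum>i\<in>UNIV. (h *\<^sub>R v) $ i * pd i F (\<gamma> s)) = h * (grad F (\<gamma> s) \<bullet> v)" for h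
        by (simp add: inner_vec_def grad_def sum_distrib_left mult_ac)
      ultimately show ?thesis by simp
    qed
    from mvt_simple[OF zero_less_one this] obtain s where s: "0 < s" "s < 1"
      and mv: "F (\<gamma> 1) - F (\<gamma> 0) = (1 - 0) * (grad F (\<gamma> s) \<bullet> v)" by auto
    have Fp: "F p = grad F (\<gamma> s) \<bullet> v" using mv crit(1) by (simp add: \<gamma>_def v_def)
    have "norm (\<gamma> s - p0) < d" using dist[of s] s v(2) by (simp add: dist_norm)
    from d(2)[OF this] have "norm (grad F (\<gamma> s) - s *\<^sub>R ?D v) \<le> B / 2 * (s * norm v)"
      using crit(2) s(1) by (simp add: \<gamma>_def linear_scale[OF lin])
    then have "\<bar>(grad F (\<gamma> s) - s *\<^sub>R ?D v) \<bullet> v\<bar> \<le> B / 2 * (s * norm v) * norm v"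
      by (meson Cauchy_Schwarz_ineq2 mult_right_mono norm_ge_zero order_trans)
    then have "\<bar>F p - s * (?D v \<bullet> v)\<bar> \<le> s * (B / 2 * (norm v)\<^sup>2)"
      unfolding Fp by (simp add: inner_diff_left power2_eq_square mult_ac)
    \<comment> \<open>The factor \<open>s\<close> occurs both in the error and in the main term, so
      it does not matter how small it is; it only has to be positive, which the open interval in the
      mean value theorem guarantees.\<close>
    moreover have "s * (B / 2 * (norm v)\<^sup>2) < s * \<bar>?D v \<bullet> v\<bar>"
    proof (rule mult_strict_left_mono[OF _ s(1)])
      have "B / 2 * (norm v)\<^sup>2 < B * (norm v)\<^sup>2" using B v(1) by simp
      then show "B / 2 * (norm v)\<^sup>2 < \<bar>?D v \<bullet> v\<bar>" using low[of v] by linarith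
    qed
    ultimately show "F p \<noteq> 0" using s(1) by (auto simp: abs_mult)
  qed
qed

text \<open>At a common zero the Leibniz rule leaves only the symmetrised product of the two
  gradients, and this form annihilates every vector orthogonal to both of them.\<close>

lemma hessian_product_degenerate:
  fixes f h :: "real^'n \<Rightarrow> real"
  assumes n: "CARD('n) \<ge> 3"
    and d: "eventually (\<lambda>p. f differentiable (at p)) (nhds p0)"
      "eventually (\<lambda>p. h differentiable (at p)) (nhds p0)"
    and dd: "\<And>b. pd b f differentiable (at p0)" "\<And>b. pd b h differentiable (at p0)"
    and z: "f p0 = 0" "h p0 = 0"
  obtains v where "v \<noteq> 0" "v v* hessian (\<lambda>p. f p * h p) p0 = 0"
proof -
  have d0: "f differentiable (at p0)" "h differentiable (at p0)"
    using d eventually_nhds_x_imp_x by fast+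
  have H: "pd a (pd b (\<lambda>p. f p * h p)) p0 = pd a f p0 * pd b h p0 + pd b f p0 * pd a h p0" for a b
  proof -
    have "eventually (\<lambda>p. pd b (\<lambda>p. f p * h p) p = f p * pd b h p + pd b f p * h p) (nhds p0)"
      using d by eventually_elim (rule pd_mult)
    then have "pd a (pd b (\<lambda>p. f p * h p)) p0 = pd a (\<lambda>p. f p * pd b h p + pd b f p * h p) p0"
      by (rule pd_cong_eventually)
    also have "\<dots> = pd a f p0 * pd b h p0 + pd b f p0 * pd a h p0"
      using d0 dd z by (simp add: pd_add pd_mult)
    finally show ?thesis .
  qed
  \<comment> \<open>The bound 2 covers equal or vanishing gradients as well, since the cardinality
    of the set can only drop.\<close>
  have "dim {grad f p0, grad h p0} \<le> card {grad f p0, grad h p0}"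
    by (rule dim_le_card) (auto intro: span_base)
  also have "\<dots> \<le> 2" by (simp add: card_insert_if)
  finally have "dim {grad f p0, grad h p0} < DIM(real^'n)" using n by simp
  from orthogonal_to_subspace_exists[OF this] obtain v where v: "v \<noteq> 0"
    "\<And>y. y \<in> span {grad f p0, grad h p0} \<Longrightarrow> orthogonal v y" by blast
  have "grad f p0 \<bullet> v = 0" "grad h p0 \<bullet> v = 0"
    using v(2)[OF span_base, of "grad f p0"] v(2)[OF span_base, of "grad h p0"]
    by (simp_all add: orthogonal_def inner_commute)
  then have fv: "(\<Sum>a\<in>UNIV. pd a f p0 * v $ a) = 0" and hv: "(\<Sum>a\<in>UNIV. pd a h p0 * v $ a) = 0"
    by (simp_all add: grad_def inner_vec_def)
  have "(v v* hessian (\<lambda>p. f p * h p) p0) $ b = 0" for b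
  proof -
    have "(v v* hessian (\<lambda>p. f p * h p) p0) $ b =
        (\<Sum>a\<in>UNIV. (pd a f p0 * pd b h p0 + pd b f p0 * pd a h p0) * v $ a)"
      by (simp add: vector_matrix_mult_def hessian_def H mult.commute)
    also have "\<dots> = pd b h p0 * (\<Sum>a\<in>UNIV. pd a f p0 * v $ a) + pd b f p0 * (\<Sum>a\<in>UNIV. pd a h p0 * v $ a)"
      by (simp add: sum_distrib_left sum.distrib[symmetric] algebra_simps)
    finally show ?thesis using fv hv by simp
  qed
  then show ?thesis using that v(1) by (simp add: vec_eq_iff)
qed

section \<open>Charts\<close>

context
  fixes A :: "('m::{t2_space, second_countable_topology}, 'n::finite) chart set" and \<kappa>
  assumes A: "smooth_atlas A" and \<kappa>: "\<kappa> \<in> A"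
begin

lemma open_dom_of: "open (dom_of \<kappa>)"
  and open_coord_image: "open (coord \<kappa> ` dom_of \<kappa>)"
  using A \<kappa> by (auto simp: smooth_atlas_def)

lemma chart_homeomorphism:
  "homeomorphism (dom_of \<kappa>) (coord \<kappa> ` dom_of \<kappa>) (coord \<kappa>) (inv_into (dom_of \<kappa>) (coord \<kappa>))"
  using A \<kappa> by (auto simp: smooth_atlas_def)

lemma inv_coord: "x \<in> dom_of \<kappa> \<Longrightarrow> inv_into (dom_of \<kappa>) (coord \<kappa>) (coord \<kappa> x) = x"
  using chart_homeomorphism by (rule homeomorphism_apply1)

lemma local_rep_coord: "x \<in> dom_of \<kappa> \<Longrightarrow> local_rep \<kappa> f (coord \<kappa> x) = f x"
  by (simp add: local_rep_def inv_coord)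

lemma local_rep_pderiv_chart:
  "p \<in> coord \<kappa> ` dom_of \<kappa> \<Longrightarrow> local_rep \<kappa> (pderiv_chart \<kappa> i f) p = pd i (local_rep \<kappa> f) p"
  by (auto simp: local_rep_coord pderiv_chart_def)

text \<open>Outside the image of the chart \<open>inv_into\<close> is unspecified, so the two inner
  functions are known to agree only on that image; as it is open, this determines the outer
  derivative.\<close>

lemma pderiv_chart_twice:
  assumes "x \<in> dom_of \<kappa>"
  shows "pderiv_chart \<kappa> j (pderiv_chart \<kappa> i f) x = pd j (pd i (local_rep \<kappa> f)) (coord \<kappa> x)"
  unfolding pderiv_chart_def[of \<kappa> j]
  using assms by (intro pd_cong_on[OF open_coord_image] local_rep_pderiv_chart) auto

lemma eventually_nhds_coord:
  assumes x: "x \<in> dom_of \<kappa>" and Q: "eventually Q (nhds (coord \<kappa> x))"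
  shows "eventually (\<lambda>y. Q (coord \<kappa> y)) (nhds x)"
proof -
  have "isCont (coord \<kappa>) x"
    using homeomorphism_cont1[OF chart_homeomorphism] open_dom_of x
    by (simp add: continuous_on_eq_continuous_at)
  then have "(coord \<kappa> \<longlongrightarrow> coord \<kappa> x) (nhds x)"
    by (simp add: isCont_def tendsto_at_iff_tendsto_nhds)
  with Q show ?thesis by (rule eventually_compose_filterlim)
qed

text \<open>Punctured neighbourhoods correspond because the chart is injective on its
  domain.\<close>

lemma eventually_at_coord:
  assumes x: "x \<in> dom_of \<kappa>" and Q: "eventually Q (at (coord \<kappa> x))"
  shows "eventually (\<lambda>y. Q (coord \<kappa> y)) (at x)"
proof -
  have "eventually (\<lambda>p. p \<noteq> coord \<kappa> x \<longrightarrow> Q p) (nhds (coord \<kappa> x))"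
    using Q by (simp add: eventually_at_filter)
  from eventually_nhds_coord[OF x this] eventually_nhds_in_open[OF open_dom_of x]
  show ?thesis unfolding eventually_at_filter
    by eventually_elim (metis inv_coord x)
qed

lemma eventually_nhds_inv_coord:
  assumes x: "x \<in> dom_of \<kappa>" and Q: "eventually Q (nhds x)"
  shows "eventually (\<lambda>p. Q (inv_into (dom_of \<kappa>) (coord \<kappa>) p)) (nhds (coord \<kappa> x))"
proof -
  have "isCont (inv_into (dom_of \<kappa>) (coord \<kappa>)) (coord \<kappa> x)"
    using homeomorphism_cont2[OF chart_homeomorphism] open_coord_image x
    by (simp add: continuous_on_eq_continuous_at)
  then have "(inv_into (dom_of \<kappa>) (coord \<kappa>) \<longlongrightarrow> x) (nhds (coord \<kappa> x))"
    using inv_coord[OF x] by (metis isCont_def tendsto_at_iff_tendsto_nhds)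
  with Q show ?thesis by (rule eventually_compose_filterlim)
qed

lemma pderiv_chart_cong:
  assumes x: "x \<in> dom_of \<kappa>" and fg: "eventually (\<lambda>y. f y = g y) (nhds x)"
  shows "pderiv_chart \<kappa> i f x = pderiv_chart \<kappa> i g x"
  unfolding pderiv_chart_def
  by (rule pd_cong_eventually) (use eventually_nhds_inv_coord[OF x fg] in \<open>simp add: local_rep_def\<close>)

lemma smooth_in_chartD:
  assumes "smooth_in_chart \<kappa> (dom_of \<kappa>) f" "p \<in> coord \<kappa> ` dom_of \<kappa>"
  shows "local_rep \<kappa> f differentiable (at p)" "pd i (local_rep \<kappa> f) differentiable (at p)"
    "isCont (local_rep \<kappa> f) p" "isCont (pd i (local_rep \<kappa> f)) p"
  using assms smooth_on_differentiable_at[OF _ open_coord_image] smooth_on_isCont[OF _ open_coord_image]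
    smooth_on_pd unfolding smooth_in_chart_def by blast+

lemma smooth_in_chart_pderiv_chart:
  assumes "smooth_in_chart \<kappa> (dom_of \<kappa>) f"
  shows "smooth_in_chart \<kappa> (dom_of \<kappa>) (pderiv_chart \<kappa> i f)"
  unfolding smooth_in_chart_def smooth_on_def
proof
  fix k
  have "Ck_on k (coord \<kappa> ` dom_of \<kappa>) (pd i (local_rep \<kappa> f))"
    using smooth_on_pd assms unfolding smooth_in_chart_def smooth_on_def by blast
  then show "Ck_on k (coord \<kappa> ` dom_of \<kappa>) (local_rep \<kappa> (pderiv_chart \<kappa> i f))"
    by (rule Ck_on_cong[OF open_coord_image _ local_rep_pderiv_chart])
qed

lemma smooth_in_chart_isCont:
  assumes f: "smooth_in_chart \<kappa> (dom_of \<kappa>) f" and x: "x \<in> dom_of \<kappa>"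
  shows "isCont f x"
proof -
  have "isCont (coord \<kappa>) x"
    using homeomorphism_cont1[OF chart_homeomorphism] open_dom_of x
    by (simp add: continuous_on_eq_continuous_at)
  then have "isCont (\<lambda>y. local_rep \<kappa> f (coord \<kappa> y)) x"
    by (rule isCont_o2) (use smooth_in_chartD(3)[OF f] x in blast)
  moreover have "eventually (\<lambda>y. local_rep \<kappa> f (coord \<kappa> y) = f y) (nhds x)"
    using eventually_nhds_in_open[OF open_dom_of x] by eventually_elim (rule local_rep_coord)
  ultimately show ?thesis
    using isCont_cong[of "\<lambda>y. local_rep \<kappa> f (coord \<kappa> y)" f x] by blast
qed

lemma pderiv_chart_add:
  assumes f: "smooth_in_chart \<kappa> (dom_of \<kappa>) f" and g: "smooth_in_chart \<kappa> (dom_of \<kappa>) g"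
    and x: "x \<in> dom_of \<kappa>"
  shows "pderiv_chart \<kappa> i (\<lambda>y. f y + g y) x = pderiv_chart \<kappa> i f x + pderiv_chart \<kappa> i g x"
proof -
  have "local_rep \<kappa> (\<lambda>y. f y + g y) = (\<lambda>p. local_rep \<kappa> f p + local_rep \<kappa> g p)"
    by (simp add: local_rep_def comp_def)
  then show ?thesis
    using smooth_in_chartD(1)[OF f] smooth_in_chartD(1)[OF g] x
    by (simp add: pderiv_chart_def pd_add)
qed

lemma pderiv_chart_twice_add:
  assumes f: "smooth_in_chart \<kappa> (dom_of \<kappa>) f" and g: "smooth_in_chart \<kappa> (dom_of \<kappa>) g"
    and x: "x \<in> dom_of \<kappa>"
  shows "pderiv_chart \<kappa> j (pderiv_chart \<kappa> i (\<lambda>y. f y + g y)) x =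
    pderiv_chart \<kappa> j (pderiv_chart \<kappa> i f) x + pderiv_chart \<kappa> j (pderiv_chart \<kappa> i g) x"
proof -
  have p: "coord \<kappa> x \<in> coord \<kappa> ` dom_of \<kappa>" using x by simp
  have "pd j (pd i (local_rep \<kappa> (\<lambda>y. f y + g y))) (coord \<kappa> x) =
      pd j (\<lambda>p. pd i (local_rep \<kappa> f) p + pd i (local_rep \<kappa> g) p) (coord \<kappa> x)"
  proof (rule pd_cong_on[OF open_coord_image p])
    fix q assume q: "q \<in> coord \<kappa> ` dom_of \<kappa>"
    have "local_rep \<kappa> (\<lambda>y. f y + g y) = (\<lambda>p. local_rep \<kappa> f p + local_rep \<kappa> g p)"
      by (simp add: local_rep_def comp_def)
    then show "pd i (local_rep \<kappa> (\<lambda>y. f y + g y)) q = pd i (local_rep \<kappa> f) q + pd i (local_rep \<kappa> g) q"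
      using smooth_in_chartD(1)[OF f q] smooth_in_chartD(1)[OF g q] by (simp add: pd_add)
  qed
  also have "\<dots> = pd j (pd i (local_rep \<kappa> f)) (coord \<kappa> x) + pd j (pd i (local_rep \<kappa> g)) (coord \<kappa> x)"
    by (intro pd_add smooth_in_chartD(2) f g p)
  finally show ?thesis unfolding pderiv_chart_twice[OF x] .
qed

lemma pderiv_chart_const: "pderiv_chart \<kappa> i (\<lambda>y. c) = (\<lambda>y. 0)"
proof -
  have "local_rep \<kappa> (\<lambda>y. c) = (\<lambda>p. c)" by (simp add: local_rep_def comp_def)
  then show ?thesis by (intro ext) (simp only: pderiv_chart_def pd_const)
qed

section \<open>Local bounds on the coefficients of the system\<close>

lemma local_rep_bigo_1:
  assumes f: "smooth_in_chart \<kappa> (dom_of \<kappa>) f" and p: "p \<in> coord \<kappa> ` dom_of \<kappa>"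
  shows "local_rep \<kappa> f \<in> O[nhds p](\<lambda>_. 1)" "local_rep \<kappa> (pderiv_chart \<kappa> i f) \<in> O[nhds p](\<lambda>_. 1)"
proof -
  show "local_rep \<kappa> f \<in> O[nhds p](\<lambda>_. 1)"
    by (rule isCont_bigo_1[OF smooth_in_chartD(3)[OF f p]])
  have "eventually (\<lambda>q. local_rep \<kappa> (pderiv_chart \<kappa> i f) q = pd i (local_rep \<kappa> f) q) (nhds p)"
    using eventually_nhds_in_open[OF open_coord_image p]
    by eventually_elim (rule local_rep_pderiv_chart)
  then show "local_rep \<kappa> (pderiv_chart \<kappa> i f) \<in> O[nhds p](\<lambda>_. 1)"
    using isCont_bigo_1[OF smooth_in_chartD(4)[OF f p]] landau_o.big.in_cong by blast
qed

text \<open>The metric and its first derivatives are continuous and the inverse is bounded by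
  \<open>matrix_inv_bigo_1\<close>; a Christoffel symbol is a sum of products of such
  functions.\<close>

lemma metric_bigo_1:
  assumes g: "metric A g" and p: "p \<in> coord \<kappa> ` dom_of \<kappa>"
  shows "local_rep \<kappa> (\<lambda>x. g \<kappa> x $ a $ b) \<in> O[nhds p](\<lambda>_. 1)"
    and "local_rep \<kappa> (\<lambda>x. ginv g \<kappa> x a b) \<in> O[nhds p](\<lambda>_. 1)"
    and "local_rep \<kappa> (christoffel g \<kappa> e a b) \<in> O[nhds p](\<lambda>_. 1)"
proof -
  have sm: "smooth_in_chart \<kappa> (dom_of \<kappa>) (\<lambda>x. g \<kappa> x $ i $ j)" for i j
    using g \<kappa> by (auto simp: metric_def smooth_tensor2_def)
  show "local_rep \<kappa> (\<lambda>x. g \<kappa> x $ a $ b) \<in> O[nhds p](\<lambda>_. 1)"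
    by (rule local_rep_bigo_1[OF sm p])
  have inv: "local_rep \<kappa> (\<lambda>x. ginv g \<kappa> x i j) \<in> O[nhds p](\<lambda>_. 1)" for i j
  proof -
    define G where "G = g \<kappa> \<circ> inv_into (dom_of \<kappa>) (coord \<kappa>)"
    have "eventually (\<lambda>q. invertible (G q)) (nhds p)"
      using eventually_nhds_in_open[OF open_coord_image p]
      by eventually_elim (use g \<kappa> in \<open>auto simp: G_def metric_def inv_coord\<close>)
    moreover have "isCont (\<lambda>q. G q $ k $ l) p" for k l
      using smooth_in_chartD(3)[OF sm p] by (simp add: G_def local_rep_def comp_def)
    ultimately have "(\<lambda>q. matrix_inv (G q) $ i $ j) \<in> O[nhds p](\<lambda>_. 1)"
      by (intro matrix_inv_bigo_1)
    then show ?thesis by (simp add: G_def local_rep_def comp_def ginv_def)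
  qed
  then show "local_rep \<kappa> (\<lambda>x. ginv g \<kappa> x a b) \<in> O[nhds p](\<lambda>_. 1)" .
  have "(\<lambda>p. (1/2) * (\<Sum>k\<in>UNIV. local_rep \<kappa> (\<lambda>x. ginv g \<kappa> x e k) p *
      (local_rep \<kappa> (pderiv_chart \<kappa> a (\<lambda>y. g \<kappa> y $ b $ k)) p
        + local_rep \<kappa> (pderiv_chart \<kappa> b (\<lambda>y. g \<kappa> y $ a $ k)) p
        - local_rep \<kappa> (pderiv_chart \<kappa> k (\<lambda>y. g \<kappa> y $ a $ b)) p))) \<in> O[nhds p](\<lambda>_. 1)"
    by (intro bigo_1_mult bigo_const sum_in_bigo big_sum_in_bigo inv local_rep_bigo_1(2)[OF sm p])
  then show "local_rep \<kappa> (christoffel g \<kappa> e a b) \<in> O[nhds p](\<lambda>_. 1)"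
    by (simp add: local_rep_def comp_def christoffel_def)
qed

end

lemma atlas_chart:
  assumes "smooth_atlas A"
  obtains \<kappa> where "\<kappa> \<in> A" "x \<in> dom_of \<kappa>"
  using assms unfolding smooth_atlas_def by (metis UNIV_I UN_iff)

section \<open>Smooth functions and densities\<close>

lemma smooth_in_chart_mult:
  assumes "smooth_atlas A" "\<kappa> \<in> A" "smooth_in_chart \<kappa> (dom_of \<kappa>) f" "smooth_in_chart \<kappa> (dom_of \<kappa>) g"
  shows "smooth_in_chart \<kappa> (dom_of \<kappa>) (\<lambda>x. f x * g x)"
  using smooth_on_mult[OF open_coord_image[OF assms(1,2)]] assms(3,4)
  by (simp add: smooth_in_chart_def local_rep_def comp_def)

lemma smooth_fun_const: "smooth_fun A (\<lambda>x. c)"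
  using Ck_on_const
  by (auto simp: smooth_fun_def smooth_in_chart_def smooth_on_def local_rep_def comp_def)

lemma smooth_fun_mult:
  assumes "smooth_atlas A" "smooth_fun A f" "smooth_fun A g"
  shows "smooth_fun A (\<lambda>x. f x * g x)"
  using assms smooth_in_chart_mult unfolding smooth_fun_def by blast

lemma smooth_fun_inverse:
  assumes A: "smooth_atlas A" and "smooth_fun A f" "\<And>x. f x \<noteq> 0"
  shows "smooth_fun A (\<lambda>x. inverse (f x))"
  using assms Ck_on_inverse[OF open_coord_image[OF A]]
  by (simp add: smooth_fun_def smooth_in_chart_def smooth_on_def local_rep_def comp_def)

lemma smooth_fun_sqrt:
  assumes A: "smooth_atlas A" and "smooth_fun A f" "\<And>x. f x > 0"
  shows "smooth_fun A (\<lambda>x. sqrt (f x))"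
  using assms Ck_on_sqrt[OF open_coord_image[OF A]]
  by (simp add: smooth_fun_def smooth_in_chart_def smooth_on_def local_rep_def comp_def)

section \<open>Changes of scale\<close>

lemma metric_rescale:
  assumes A: "smooth_atlas A" and g: "metric A g" and f: "smooth_fun A f" "\<And>x. f x > 0"
  shows "metric A (rescale f g)"
proof -
  have "smooth_tensor2 A (rescale f g)"
    unfolding smooth_tensor2_def
  proof (intro conjI ballI allI)
    fix \<kappa> i j assume \<kappa>: "\<kappa> \<in> A"
    then show "smooth_in_chart \<kappa> (dom_of \<kappa>) (\<lambda>x. rescale f g \<kappa> x $ i $ j)"
      using f(1) g smooth_in_chart_mult[OF A \<kappa>]
      by (simp add: rescale_def metric_def smooth_tensor2_def smooth_fun_def)
  next
    fix \<kappa> \<kappa>' x i j assume "\<kappa> \<in> A" "\<kappa>' \<in> A" "x \<in> dom_of \<kappa> \<inter> dom_of \<kappa>'"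
    then have "g \<kappa>' x $ i $ j =
          (\<Sum>k\<in>UNIV. \<Sum>l\<in>UNIV. pderiv_chart \<kappa>' i (\<lambda>y. coord \<kappa> y $ k) x *
             pderiv_chart \<kappa>' j (\<lambda>y. coord \<kappa> y $ l) x * g \<kappa> x $ k $ l)"
      using g unfolding metric_def smooth_tensor2_def by blast
    then show "rescale f g \<kappa>' x $ i $ j =
          (\<Sum>k\<in>UNIV. \<Sum>l\<in>UNIV. pderiv_chart \<kappa>' i (\<lambda>y. coord \<kappa> y $ k) x *
             pderiv_chart \<kappa>' j (\<lambda>y. coord \<kappa> y $ l) x * rescale f g \<kappa> x $ k $ l)"
      by (simp add: rescale_def sum_distrib_left mult_ac)
  qed
  moreover have "symmetric_tensor2 A (rescale f g)"
    using g by (simp add: metric_def symmetric_tensor2_def rescale_def transpose_scalar)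
  moreover have "invertible (rescale f g \<kappa> x)" if "\<kappa> \<in> A" "x \<in> dom_of \<kappa>" for \<kappa> x
    using g that f(2)[of x] unfolding metric_def rescale_def
    by (intro scalar_invertible) auto
  ultimately show ?thesis by (simp add: metric_def)
qed

lemma conformal_class_metric:
  assumes "smooth_atlas A" "conformal_class A c" "g \<in> c"
  shows "metric A g"
  using assms metric_rescale unfolding conformal_class_def by blast

lemma density_change_scale:
  assumes A: "smooth_atlas A" and c: "conformal_class A c" and \<sigma>: "\<sigma> \<in> densities A c w"
    and g: "g \<in> c" and g': "g' \<in> c"
  obtains \<Omega> where "\<And>x. \<Omega> x > 0" "\<And>x. \<sigma> g' x = \<Omega> x powr w * \<sigma> g x"
proof -
  obtain h f f' where f: "g = rescale f h" "smooth_fun A f" "\<And>x. f x > 0"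
    and f': "g' = rescale f' h" "smooth_fun A f'" "\<And>x. f' x > 0"
    using c g g' unfolding conformal_class_def by auto
  \<comment> \<open>Both metrics are positive multiples of \<open>h\<close>, whereas the density law
    speaks of squares; the square root of the quotient of the multipliers is the factor that leads
    from \<open>g\<close> to \<open>g'\<close>.\<close>
  define \<Omega> where "\<Omega> x = sqrt (f' x * inverse (f x))" for x
  have pos: "f' x * inverse (f x) > 0" for x using f(3) f'(3) by simp
  have "f x \<noteq> 0" for x using f(3)[of x] by simp
  then have sm: "smooth_fun A \<Omega>"
    unfolding \<Omega>_def using pos
    by (intro smooth_fun_sqrt smooth_fun_mult smooth_fun_inverse A f(2) f'(2))
  have \<Omega>: "\<Omega> x > 0" for x using pos by (simp add: \<Omega>_def)
  have "(\<Omega> x)\<^sup>2 * f x = f' x" for x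
    using pos[of x] f(3)[of x] by (simp add: \<Omega>_def)
  then have "g' = rescale (\<lambda>y. (\<Omega> y)\<^sup>2) g"
    by (simp add: f(1) f'(1) rescale_def)
  then have "\<sigma> g' x = \<Omega> x powr w * \<sigma> g x" for x
    using \<sigma> g sm \<Omega> by (simp add: densities_def)
  with \<Omega> show ?thesis by (rule that)
qed

lemma zero_density_in_densities: "zero_density \<in> densities A c w"
  using smooth_fun_const by (auto simp: densities_def zero_density_def)

section \<open>Jets and the slots of a parallel tractor\<close>

lemma jetD:
  assumes "\<tau> \<in> jet A c w k x \<sigma>" "g \<in> c" "\<kappa> \<in> A" "x \<in> dom_of \<kappa>"
  shows "\<tau> g x = \<sigma> g x"
    and "k \<ge> 1 \<Longrightarrow> pderiv_chart \<kappa> a (\<tau> g) x = pderiv_chart \<kappa> a (\<sigma> g) x"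
    and "k \<ge> 2 \<Longrightarrow> pderiv_chart \<kappa> a (pderiv_chart \<kappa> b (\<tau> g)) x =
      pderiv_chart \<kappa> a (pderiv_chart \<kappa> b (\<sigma> g)) x"
proof -
  have *: "foldr (pderiv_chart \<kappa>) is (\<tau> g) x = foldr (pderiv_chart \<kappa>) is (\<sigma> g) x"
    if "length is \<le> k" for "is"
    using assms that unfolding jet_def by blast
  show "\<tau> g x = \<sigma> g x"
    and "k \<ge> 1 \<Longrightarrow> pderiv_chart \<kappa> a (\<tau> g) x = pderiv_chart \<kappa> a (\<sigma> g) x"
    and "k \<ge> 2 \<Longrightarrow> pderiv_chart \<kappa> a (pderiv_chart \<kappa> b (\<tau> g)) x =
      pderiv_chart \<kappa> a (pderiv_chart \<kappa> b (\<sigma> g)) x"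
    using *[of "[]"] *[of "[a]"] *[of "[a, b]"] by simp_all
qed

lemma jet_refl: "\<sigma> \<in> densities A c w \<Longrightarrow> \<sigma> \<in> jet A c w k x \<sigma>"
  by (simp add: jet_def)

text \<open>Jets are sets of sections. Equality with the zero jet is tested on the member
  \<open>\<sigma>\<close>; conversely, equal derivatives up to order one make the two defining
  conditions coincide.\<close>

lemma jet_vanishes_1_iff:
  assumes A: "smooth_atlas A" and \<sigma>: "\<sigma> \<in> densities A c w"
  shows "jet_vanishes A c w 1 \<sigma> x \<longleftrightarrow> (\<forall>g\<in>c. \<forall>\<kappa>\<in>A. x \<in> dom_of \<kappa> \<longrightarrow>
    \<sigma> g x = 0 \<and> (\<forall>a. pderiv_chart \<kappa> a (\<sigma> g) x = 0))" (is "?L \<longleftrightarrow> ?R")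
proof
  assume ?L
  then have \<sigma>0: "\<sigma> \<in> jet A c w 1 x zero_density"
    using jet_refl[OF \<sigma>, of 1 x] unfolding jet_vanishes_def by blast
  show ?R
    using jetD(1,2)[OF \<sigma>0] pderiv_chart_const[OF A] unfolding zero_density_def
    by (metis order_refl)
next
  assume R: ?R
  have "foldr (pderiv_chart \<kappa>) is (\<sigma> g) x = foldr (pderiv_chart \<kappa>) is (zero_density g) x"
    if "g \<in> c" "\<kappa> \<in> A" "x \<in> dom_of \<kappa>" "length is \<le> 1" for g \<kappa> "is"
  proof (cases "is")
    case Nil
    then show ?thesis using R that by (simp add: zero_density_def)
  next
    case (Cons a as)
    then show ?thesis using R that by (simp add: zero_density_def pderiv_chart_const[OF A that(2)])
  qed
  then show ?L unfolding jet_vanishes_def jet_def by fastforce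
qed

text \<open>The representative and \<open>\<sigma>\<close> differ, up to second order, by a section
  with vanishing 1-jet and trace-free second derivatives. Values and first derivatives therefore
  agree; so do the Laplacians, since their Christoffel terms see only first derivatives and the
  trace of the difference is zero.\<close>

lemma representative_tractor_D:
  fixes A :: "('m::{t2_space, second_countable_topology}, 'n::finite) chart set"
  assumes A: "smooth_atlas A" and \<sigma>: "\<sigma> \<in> densities A c 1"
    and g: "g \<in> c" and \<kappa>: "\<kappa> \<in> A" and x: "x \<in> dom_of \<kappa>"
  defines "\<tau> \<equiv> representative A c x (tractor_D A c \<sigma> x)"
  shows "\<tau> g x = \<sigma> g x" "pderiv_chart \<kappa> a (\<tau> g) x = pderiv_chart \<kappa> a (\<sigma> g) x"
    "laplacian g \<kappa> (\<tau> g) x = laplacian g \<kappa> (\<sigma> g) x"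
proof -
  have "\<tau> \<in> densities A c 1 \<and> jet_coset A c x (jet A c 1 2 x \<tau>) = tractor_D A c \<sigma> x"
    unfolding \<tau>_def representative_def by (rule someI[of _ \<sigma>]) (simp add: \<sigma> tractor_D_def)
  then have \<tau>: "\<tau> \<in> densities A c 1"
    and coset: "jet_coset A c x (jet A c 1 2 x \<tau>) = jet_coset A c x (jet A c 1 2 x \<sigma>)"
    by (simp_all add: tractor_D_def)
  \<comment> \<open>The zero jet is trace-free, which puts the 2-jet of \<open>\<sigma>\<close> into
    its own coset.\<close>
  have "jet A c 1 2 x zero_density \<in> tracefree_jets A c x"
    unfolding tracefree_jets_def mem_Collect_eq
  proof (intro exI conjI ballI impI)
    fix h \<kappa>' assume "\<kappa>' \<in> A"
    then show "(\<Sum>a\<in>UNIV. \<Sum>b\<in>UNIV. ginv h \<kappa>' x a b *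
        pderiv_chart \<kappa>' a (pderiv_chart \<kappa>' b (zero_density h)) x) = 0"
      by (simp add: zero_density_def pderiv_chart_const[OF A])
  qed (simp_all add: zero_density_in_densities jet_vanishes_def)
  then have zero: "zero_density \<in> \<Union> (tracefree_jets A c x)"
    using jet_refl[OF zero_density_in_densities, of A c 1 2 x] by blast
  have "add_density \<sigma> zero_density = \<sigma>" by (simp add: add_density_def zero_density_def)
  then have "jet A c 1 2 x \<sigma> \<in> jet_coset A c x (jet A c 1 2 x \<sigma>)"
    unfolding jet_coset_def using zero jet_refl[OF \<sigma>, of 2 x] by force
  \<comment> \<open>The same membership, read in the equal coset of \<open>\<tau>\<close>, writes
    the 2-jet of \<open>\<sigma>\<close> as that of \<open>\<tau>\<close> plus a trace-free
    one.\<close>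
  then obtain \<tau>' \<eta> where \<tau>': "\<tau>' \<in> jet A c 1 2 x \<tau>" and \<eta>: "\<eta> \<in> \<Union> (tracefree_jets A c x)"
    and sum: "jet A c 1 2 x \<sigma> = jet A c 1 2 x (add_density \<tau>' \<eta>)"
    unfolding coset[symmetric] unfolding jet_coset_def by blast
  from \<eta> obtain \<eta>0 where \<eta>0: "\<eta> \<in> jet A c 1 2 x \<eta>0" "\<eta>0 \<in> densities A c 1"
    "jet_vanishes A c 1 1 \<eta>0 x"
    and tr: "(\<Sum>a\<in>UNIV. \<Sum>b\<in>UNIV. ginv g \<kappa> x a b *
           pderiv_chart \<kappa> a (pderiv_chart \<kappa> b (\<eta>0 g)) x) = 0"
    unfolding tracefree_jets_def using g \<kappa> x by blast
  have \<sigma>': "\<sigma> \<in> jet A c 1 2 x (add_density \<tau>' \<eta>)" using jet_refl[OF \<sigma>, of 2 x] sum by blast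
  note D\<sigma> = jetD[OF \<sigma>' g \<kappa> x] and D\<tau> = jetD[OF \<tau>' g \<kappa> x] and D\<eta> = jetD[OF \<eta>0(1) g \<kappa> x]
  have \<eta>z: "\<eta>0 g x = 0" "pderiv_chart \<kappa> a (\<eta>0 g) x = 0" for a
    using jet_vanishes_1_iff[OF A \<eta>0(2)] \<eta>0(3) g \<kappa> x by blast+
  have sm: "smooth_in_chart \<kappa> (dom_of \<kappa>) (\<tau>' g)" "smooth_in_chart \<kappa> (dom_of \<kappa>) (\<eta> g)"
    using \<tau>' \<eta>0(1) g \<kappa> by (auto simp: jet_def densities_def smooth_fun_def)
  have add: "add_density \<tau>' \<eta> g = (\<lambda>y. \<tau>' g y + \<eta> g y)" by (simp add: add_density_def)
  show v: "\<tau> g x = \<sigma> g x"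
    using D\<sigma>(1) D\<tau>(1) D\<eta>(1) \<eta>z(1) by (simp add: add)
  have d: "pderiv_chart \<kappa> a (\<tau> g) x = pderiv_chart \<kappa> a (\<sigma> g) x" for a
    using D\<sigma>(2)[of a] D\<tau>(2)[of a] D\<eta>(2)[of a] \<eta>z(2)
    by (simp add: add pderiv_chart_add[OF A \<kappa> sm x])
  then show "pderiv_chart \<kappa> a (\<tau> g) x = pderiv_chart \<kappa> a (\<sigma> g) x" .
  have dd: "pderiv_chart \<kappa> a (pderiv_chart \<kappa> b (\<sigma> g)) x =
      pderiv_chart \<kappa> a (pderiv_chart \<kappa> b (\<tau> g)) x + pderiv_chart \<kappa> a (pderiv_chart \<kappa> b (\<eta>0 g)) x" for a b
    using D\<sigma>(3)[of a b] D\<tau>(3)[of a b] D\<eta>(3)[of a b]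
    by (simp add: add pderiv_chart_twice_add[OF A \<kappa> sm x])
  have "laplacian g \<kappa> (\<sigma> g) x = laplacian g \<kappa> (\<tau> g) x +
      (\<Sum>a\<in>UNIV. \<Sum>b\<in>UNIV. ginv g \<kappa> x a b * pderiv_chart \<kappa> a (pderiv_chart \<kappa> b (\<eta>0 g)) x)"
    unfolding laplacian_def nabla_form_def dd d sum.distrib[symmetric]
    by (simp add: algebra_simps)
  then show "laplacian g \<kappa> (\<tau> g) x = laplacian g \<kappa> (\<sigma> g) x" using tr by simp
qed

text \<open>Here \<open>f\<close> trivialises \<open>\<sigma>\<close> in the scale \<open>g\<close>; since \<open>\<sigma>\<close> and \<open>\<nabla>\<^sub>a \<sigma>\<close> are the
  top and middle slots, only the middle and bottom slots of the connection give equations.\<close>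

locale parallel_scale =
  fixes A :: "('m::{t2_space, second_countable_topology}, 'n::finite) chart set"
    and g P :: "('m, 'n) tensor2" and f :: "'m \<Rightarrow> real" and \<rho> :: "('m, 'n) chart \<Rightarrow> 'm \<Rightarrow> real"
  assumes atlas: "smooth_atlas A" and metric: "metric A g" and smooth_P: "smooth_tensor2 A P"
    and smooth_f: "smooth_fun A f"
    and smooth_rho: "\<kappa> \<in> A \<Longrightarrow> smooth_in_chart \<kappa> (dom_of \<kappa>) (\<rho> \<kappa>)"
    and rho_eq: "\<kappa> \<in> A \<Longrightarrow> x \<in> dom_of \<kappa> \<Longrightarrow>
      \<rho> \<kappa> x = - (1 / real CARD('n)) * (laplacian g \<kappa> f x + schouten_trace g P \<kappa> x * f x)"
    and hess_eq: "\<kappa> \<in> A \<Longrightarrow> x \<in> dom_of \<kappa> \<Longrightarrow> pderiv_chart \<kappa> a (pderiv_chart \<kappa> b f) x =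
      (\<Sum>e\<in>UNIV. christoffel g \<kappa> e a b x * pderiv_chart \<kappa> e f x)
        - g \<kappa> x $ a $ b * \<rho> \<kappa> x - P \<kappa> x $ a $ b * f x"
    and drho_eq: "\<kappa> \<in> A \<Longrightarrow> x \<in> dom_of \<kappa> \<Longrightarrow> pderiv_chart \<kappa> a (\<rho> \<kappa>) x =
      (\<Sum>b\<in>UNIV. \<Sum>e\<in>UNIV. P \<kappa> x $ a $ b * ginv g \<kappa> x b e * pderiv_chart \<kappa> e f x)"

text \<open>A pointwise choice of representatives says nothing about how the slots vary. They agree
  with the data of \<open>\<sigma>\<close> at all points of an open chart domain, and this makes it
  legitimate to differentiate the identification.\<close>

lemma parallel_tractor_D:
  fixes A :: "('m::{t2_space, second_countable_topology}, 'n::finite) chart set"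
  assumes A: "smooth_atlas A" and c: "conformal_class A c" and \<sigma>: "\<sigma> \<in> densities A c 1"
    and par: "parallel_tractor A c (tractor_D A c \<sigma>)"
  obtains g P \<rho> where "g \<in> c" "parallel_scale A g P (\<sigma> g) \<rho>"
proof -
  let ?I = "tractor_D A c \<sigma>"
  obtain g P where g: "g \<in> c" and P: "schouten_tensor A g P" and sm: "smooth_tractor A c g P ?I"
    and conn: "\<And>\<kappa> x a. \<kappa> \<in> A \<Longrightarrow> x \<in> dom_of \<kappa> \<Longrightarrow>
      tractor_connection A c g P \<kappa> ?I a x = (0, \<lambda>b. 0, 0)"
    using par unfolding parallel_tractor_def by blast
  note rep = representative_tractor_D[OF A \<sigma> g]
  have top: "top_slot A c g ?I = \<sigma> g"
  proof
    fix x obtain \<kappa> where "\<kappa> \<in> A" "x \<in> dom_of \<kappa>" using atlas_chart[OF A] .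
    then show "top_slot A c g ?I x = \<sigma> g x" unfolding top_slot_def by (rule rep(1))
  qed
  have mid: "middle_slot A c g \<kappa> ?I a x = pderiv_chart \<kappa> a (\<sigma> g) x"
    if "\<kappa> \<in> A" "x \<in> dom_of \<kappa>" for \<kappa> a x
    unfolding middle_slot_def using that by (rule rep(2))
  have dmid: "pderiv_chart \<kappa> a (middle_slot A c g \<kappa> ?I b) x = pderiv_chart \<kappa> a (pderiv_chart \<kappa> b (\<sigma> g)) x"
    if "\<kappa> \<in> A" "x \<in> dom_of \<kappa>" for \<kappa> a b x
  proof (rule pderiv_chart_cong[OF A that])
    show "eventually (\<lambda>y. middle_slot A c g \<kappa> ?I b y = pderiv_chart \<kappa> b (\<sigma> g) y) (nhds x)"
      using eventually_nhds_in_open[OF open_dom_of[OF A that(1)] that(2)]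
      by eventually_elim (rule mid[OF that(1)])
  qed
  have "parallel_scale A g P (\<sigma> g) (\<lambda>\<kappa>. bottom_slot A c g P \<kappa> ?I)"
  proof (rule parallel_scale.intro)
    show "smooth_atlas A" by (rule A)
    show "metric A g" by (rule conformal_class_metric[OF A c g])
    show "smooth_tensor2 A P" using P by (simp add: schouten_tensor_def)
    show "smooth_fun A (\<sigma> g)" using \<sigma> g by (simp add: densities_def)
    fix \<kappa> assume \<kappa>: "\<kappa> \<in> A"
    show "smooth_in_chart \<kappa> (dom_of \<kappa>) (bottom_slot A c g P \<kappa> ?I)"
      using sm \<kappa> by (simp add: smooth_tractor_def)
    fix x assume x: "x \<in> dom_of \<kappa>"
    show "bottom_slot A c g P \<kappa> ?I x =
        - (1 / real CARD('n)) * (laplacian g \<kappa> (\<sigma> g) x + schouten_trace g P \<kappa> x * \<sigma> g x)"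
      unfolding bottom_slot_def Let_def rep(1)[OF \<kappa> x] rep(3)[OF \<kappa> x] ..
    have c2: "nabla_form g \<kappa> (middle_slot A c g \<kappa> ?I) a b x + g \<kappa> x $ a $ b * bottom_slot A c g P \<kappa> ?I x
        + P \<kappa> x $ a $ b * \<sigma> g x = 0"
      and c3: "pderiv_chart \<kappa> a (bottom_slot A c g P \<kappa> ?I) x - (\<Sum>b\<in>UNIV. \<Sum>e\<in>UNIV.
        P \<kappa> x $ a $ b * ginv g \<kappa> x b e * middle_slot A c g \<kappa> ?I e x) = 0" for a b
      using conn[OF \<kappa> x, of a] by (auto simp: tractor_connection_def Let_def top fun_eq_iff)
    show "pderiv_chart \<kappa> a (pderiv_chart \<kappa> b (\<sigma> g)) x =
      (\<Sum>e\<in>UNIV. christoffel g \<kappa> e a b x * pderiv_chart \<kappa> e (\<sigma> g) x)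
        - g \<kappa> x $ a $ b * bottom_slot A c g P \<kappa> ?I x - P \<kappa> x $ a $ b * \<sigma> g x" for a b
      using c2[of a b] unfolding nabla_form_def dmid[OF \<kappa> x] mid[OF \<kappa> x] by linarith
    show "pderiv_chart \<kappa> a (bottom_slot A c g P \<kappa> ?I) x =
      (\<Sum>b\<in>UNIV. \<Sum>e\<in>UNIV. P \<kappa> x $ a $ b * ginv g \<kappa> x b e * pderiv_chart \<kappa> e (\<sigma> g) x)" for a
      using c3[of a] unfolding mid[OF \<kappa> x] by linarith
  qed
  with g show ?thesis by (rule that)
qed

section \<open>Zeros of the 1-jet\<close>

context parallel_scale
begin

lemma smooth_f_chart: "\<kappa> \<in> A \<Longrightarrow> smooth_in_chart \<kappa> (dom_of \<kappa>) f"
  using smooth_f by (simp add: smooth_fun_def)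

lemma vanishing_near:
  assumes \<kappa>: "\<kappa> \<in> A" and x: "x \<in> dom_of \<kappa>"
    and init: "f x = 0" "\<And>a. pderiv_chart \<kappa> a f x = 0" "\<rho> \<kappa> x = 0"
  shows "eventually (\<lambda>y. f y = 0) (nhds x)"
proof -
  let ?p = "coord \<kappa> x" and ?S = "coord \<kappa> ` dom_of \<kappa>"
  have p: "?p \<in> ?S" using x by simp
  have "eventually (\<lambda>p. local_rep \<kappa> f p = 0) (nhds ?p)"
  proof (rule tractor_system_vanishing[OF open_coord_image[OF atlas \<kappa>] p,
        where \<rho> = "local_rep \<kappa> (\<rho> \<kappa>)" and \<Gamma> = "\<lambda>e a b. local_rep \<kappa> (christoffel g \<kappa> e a b)"
          and G = "\<lambda>a b. local_rep \<kappa> (\<lambda>y. g \<kappa> y $ a $ b)"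
          and P = "\<lambda>a b. local_rep \<kappa> (\<lambda>y. P \<kappa> y $ a $ b)"
          and Gi = "\<lambda>a b. local_rep \<kappa> (\<lambda>y. ginv g \<kappa> y a b)"])
    fix a b e
    fix q assume q: "q \<in> ?S"
    then obtain y where y: "y \<in> dom_of \<kappa>" and qy: "q = coord \<kappa> y" by blast
    note smf = smooth_in_chartD[OF atlas \<kappa> smooth_f_chart[OF \<kappa>] q]
    show "local_rep \<kappa> f differentiable (at q)" "pd b (local_rep \<kappa> f) differentiable (at q)"
      by (rule smf)+
    show "local_rep \<kappa> (\<rho> \<kappa>) differentiable (at q)"
      by (rule smooth_in_chartD(1)[OF atlas \<kappa> smooth_rho[OF \<kappa>] q])
    show "pd a (pd b (local_rep \<kappa> f)) q =
        (\<Sum>e\<in>UNIV. local_rep \<kappa> (christoffel g \<kappa> e a b) q * pd e (local_rep \<kappa> f) q)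
        - local_rep \<kappa> (\<lambda>y. g \<kappa> y $ a $ b) q * local_rep \<kappa> (\<rho> \<kappa>) q
        - local_rep \<kappa> (\<lambda>y. P \<kappa> y $ a $ b) q * local_rep \<kappa> f q"
      using hess_eq[OF \<kappa> y, of a b] pderiv_chart_twice[OF atlas \<kappa> y, of a b f]
      by (simp add: qy local_rep_coord[OF atlas \<kappa> y] pderiv_chart_def[symmetric])
    show "pd a (local_rep \<kappa> (\<rho> \<kappa>)) q = (\<Sum>b\<in>UNIV. \<Sum>e\<in>UNIV. local_rep \<kappa> (\<lambda>y. P \<kappa> y $ a $ b) q
        * local_rep \<kappa> (\<lambda>y. ginv g \<kappa> y b e) q * pd e (local_rep \<kappa> f) q)"
      using drho_eq[OF \<kappa> y, of a]
      by (simp add: qy local_rep_coord[OF atlas \<kappa> y] pderiv_chart_def[symmetric])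
  next
    fix a b e
    show "local_rep \<kappa> (christoffel g \<kappa> e a b) \<in> O[nhds ?p](\<lambda>_. 1)"
      "local_rep \<kappa> (\<lambda>y. g \<kappa> y $ a $ b) \<in> O[nhds ?p](\<lambda>_. 1)"
      "local_rep \<kappa> (\<lambda>y. ginv g \<kappa> y a b) \<in> O[nhds ?p](\<lambda>_. 1)"
      by (rule metric_bigo_1[OF atlas \<kappa> metric p])+
    have "smooth_in_chart \<kappa> (dom_of \<kappa>) (\<lambda>y. P \<kappa> y $ a $ b)"
      using smooth_P \<kappa> by (auto simp: smooth_tensor2_def)
    then show "local_rep \<kappa> (\<lambda>y. P \<kappa> y $ a $ b) \<in> O[nhds ?p](\<lambda>_. 1)"
      by (rule local_rep_bigo_1(1)[OF atlas \<kappa> _ p])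
    show "local_rep \<kappa> f ?p = 0" "pd b (local_rep \<kappa> f) ?p = 0" "local_rep \<kappa> (\<rho> \<kappa>) ?p = 0"
      using init by (simp_all add: local_rep_coord[OF atlas \<kappa> x] pderiv_chart_def[symmetric])
  qed
  from eventually_nhds_coord[OF atlas \<kappa> x this] eventually_nhds_in_open[OF open_dom_of[OF atlas \<kappa>] x]
  show ?thesis by eventually_elim (simp add: local_rep_coord[OF atlas \<kappa>])
qed

text \<open>This is the converse of \<open>vanishing_near\<close>: \<open>rho_eq\<close> expresses
  \<open>\<rho>\<close> by \<open>f\<close> and its derivatives up to order two, all of which vanish
  where \<open>f\<close> is locally zero.\<close>

lemma slots_of_locally_zero:
  assumes \<kappa>: "\<kappa> \<in> A" and x: "x \<in> dom_of \<kappa>" and z: "eventually (\<lambda>y. f y = 0) (nhds x)"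
  shows "f x = 0" "pderiv_chart \<kappa> a f x = 0" "\<rho> \<kappa> x = 0"
proof -
  show f0: "f x = 0" using z eventually_nhds_x_imp_x by fast
  have d: "pderiv_chart \<kappa> a f y = 0" if "y \<in> dom_of \<kappa>" "eventually (\<lambda>y. f y = 0) (nhds y)" for a y
    using pderiv_chart_cong[OF atlas \<kappa> that] by (simp add: pderiv_chart_const[OF atlas \<kappa>])
  show d0: "pderiv_chart \<kappa> a f x = 0" for a using d[OF x z] .
  have "eventually (\<lambda>y. pderiv_chart \<kappa> b f y = 0) (nhds x)" for b
  proof -
    \<comment> \<open>To differentiate once more, the first derivatives must vanish near
      \<open>x\<close> and not just at \<open>x\<close>.\<close>
    have "eventually (\<lambda>y. eventually (\<lambda>y. f y = 0) (nhds y)) (nhds x)"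
      using z by (simp add: eventually_eventually)
    with eventually_nhds_in_open[OF open_dom_of[OF atlas \<kappa>] x] show ?thesis
      by eventually_elim (rule d)
  qed
  then have "pderiv_chart \<kappa> a (pderiv_chart \<kappa> b f) x = 0" for a b
    using pderiv_chart_cong[OF atlas \<kappa> x, of "pderiv_chart \<kappa> b f" "\<lambda>y. 0" a]
    by (simp add: pderiv_chart_const[OF atlas \<kappa>])
  then show "\<rho> \<kappa> x = 0"
    unfolding rho_eq[OF \<kappa> x] laplacian_def nabla_form_def by (simp add: f0 d0)
qed

lemma unique_continuation:
  assumes conn: "connected (UNIV :: 'm set)" and x: "eventually (\<lambda>y. f y = 0) (nhds x)"
  shows "f y = 0"
proof -
  \<comment> \<open>\<open>Z\<close> is open by its form and involves no chart. At a point of its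
    closure the slots in one chart vanish by continuity, and \<open>vanishing_near\<close> puts the
    point back into \<open>Z\<close>.\<close>
  define Z where "Z = {x. eventually (\<lambda>y. f y = 0) (nhds x)}"
  have "open Z"
  proof (subst open_subopen, rule ballI)
    fix x assume "x \<in> Z"
    then have "eventually (\<lambda>z. z \<in> Z) (nhds x)"
      unfolding Z_def mem_Collect_eq eventually_eventually .
    then show "\<exists>T. open T \<and> x \<in> T \<and> T \<subseteq> Z"
      unfolding eventually_nhds by blast
  qed
  moreover have "closed Z"
    unfolding closure_subset_eq[symmetric]
  proof
    fix x assume x: "x \<in> closure Z"
    obtain \<kappa> where \<kappa>: "\<kappa> \<in> A" and xk: "x \<in> dom_of \<kappa>" using atlas_chart[OF atlas] .
    have lim: "h x = 0" if h: "isCont h x" "\<And>y. y \<in> dom_of \<kappa> \<Longrightarrow> y \<in> Z \<Longrightarrow> h y = 0" for h :: "'m \<Rightarrow> real"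
    proof (rule ccontr)
      assume "h x \<noteq> 0"
      moreover have "(h \<longlongrightarrow> h x) (nhds x)"
        using h(1) by (simp add: isCont_def tendsto_at_iff_tendsto_nhds)
      ultimately have "eventually (\<lambda>y. h y \<noteq> 0) (nhds x)"
        by (rule tendsto_imp_eventually_ne[rotated])
      then have "eventually (\<lambda>y. h y \<noteq> 0 \<and> y \<in> dom_of \<kappa>) (nhds x)"
        using eventually_nhds_in_open[OF open_dom_of[OF atlas \<kappa>] xk] by eventually_elim simp
      then obtain U where U: "open U" "x \<in> U" "\<And>y. y \<in> U \<Longrightarrow> h y \<noteq> 0 \<and> y \<in> dom_of \<kappa>"
        unfolding eventually_nhds by blast
      then obtain y where "y \<in> U" "y \<in> Z"
        using x open_Int_closure_eq_empty[OF U(1), of Z] by blast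
      with U(3) h(2) show False by blast
    qed
    have zero: "f y = 0" "pderiv_chart \<kappa> a f y = 0" "\<rho> \<kappa> y = 0" if "y \<in> dom_of \<kappa>" "y \<in> Z" for y a
      using slots_of_locally_zero[OF \<kappa> that(1)] that(2) by (simp_all add: Z_def)
    note cont = smooth_in_chart_isCont[OF atlas \<kappa> _ xk]
    have "smooth_in_chart \<kappa> (dom_of \<kappa>) (pderiv_chart \<kappa> a f)" for a
      using smooth_f_chart[OF \<kappa>] smooth_in_chart_pderiv_chart[OF atlas \<kappa>] by blast
    then have "pderiv_chart \<kappa> a f x = 0" for a
      by (rule lim[OF cont zero(2)])
    moreover have "f x = 0"
      by (rule lim[OF cont[OF smooth_f_chart[OF \<kappa>]] zero(1)])
    moreover have "\<rho> \<kappa> x = 0"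
      by (rule lim[OF cont[OF smooth_rho[OF \<kappa>]] zero(3)])
    ultimately show "x \<in> Z"
      unfolding Z_def using vanishing_near[OF \<kappa> xk] by simp
  qed
  moreover have "x \<in> Z" using x by (simp add: Z_def)
  ultimately have "Z = UNIV" using conn by (auto simp: connected_clopen)
  then show ?thesis using eventually_nhds_x_imp_x unfolding Z_def by fast
qed

section \<open>Behaviour at a zero of the 1-jet\<close>

context
  fixes \<kappa> x y0
  assumes conn: "connected (UNIV :: 'm set)" and nz: "f y0 \<noteq> 0"
    and \<kappa>: "\<kappa> \<in> A" and x: "x \<in> dom_of \<kappa>"
    and crit: "f x = 0" "\<And>a. pderiv_chart \<kappa> a f x = 0"
begin

lemma rho_nonzero: "\<rho> \<kappa> x \<noteq> 0"
  using vanishing_near[OF \<kappa> x crit] unique_continuation[OF conn] nz by blast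

lemma critical_point: "local_rep \<kappa> f (coord \<kappa> x) = 0" "grad (local_rep \<kappa> f) (coord \<kappa> x) = 0"
  using crit by (simp_all add: local_rep_coord[OF atlas \<kappa> x] grad_def pderiv_chart_def vec_eq_iff)

lemma differentiable_near:
  "eventually (\<lambda>p. local_rep \<kappa> f differentiable (at p)) (nhds (coord \<kappa> x))"
  "pd b (local_rep \<kappa> f) differentiable (at (coord \<kappa> x))"
proof -
  have p: "coord \<kappa> x \<in> coord \<kappa> ` dom_of \<kappa>" using x by simp
  show "eventually (\<lambda>p. local_rep \<kappa> f differentiable (at p)) (nhds (coord \<kappa> x))"
    using eventually_nhds_in_open[OF open_coord_image[OF atlas \<kappa>] p]
    by eventually_elim (rule smooth_in_chartD(1)[OF atlas \<kappa> smooth_f_chart[OF \<kappa>]])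
  show "pd b (local_rep \<kappa> f) differentiable (at (coord \<kappa> x))"
    by (rule smooth_in_chartD(2)[OF atlas \<kappa> smooth_f_chart[OF \<kappa>] p])
qed

text \<open>At a zero of the 1-jet the Christoffel and Schouten terms of \<open>hess_eq\<close> drop
  out; symmetry of the metric then exchanges left and right multiplication.\<close>

lemma hessian_at_critical_point:
  "v v* hessian (local_rep \<kappa> f) (coord \<kappa> x) = (- \<rho> \<kappa> x) *\<^sub>R (g \<kappa> x *v v)"
proof -
  have H: "pd a (pd b (local_rep \<kappa> f)) (coord \<kappa> x) = - \<rho> \<kappa> x * g \<kappa> x $ a $ b" for a b
    using hess_eq[OF \<kappa> x, of a b] pderiv_chart_twice[OF atlas \<kappa> x, of a b f] crit by simp
  have "v v* hessian (local_rep \<kappa> f) (coord \<kappa> x) = (- \<rho> \<kappa> x) *\<^sub>R (v v* g \<kappa> x)"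
    by (simp add: vec_eq_iff vector_matrix_mult_def hessian_def H sum_distrib_left mult_ac sum_negf)
  also have "v v* g \<kappa> x = g \<kappa> x *v v"
    using metric \<kappa> x transpose_matrix_vector[of "g \<kappa> x" v]
    by (auto simp: metric_def symmetric_tensor2_def)
  finally show ?thesis .
qed

lemma hessian_nondegenerate:
  assumes "v v* hessian (local_rep \<kappa> f) (coord \<kappa> x) = 0"
  shows "v = 0"
proof -
  have "g \<kappa> x *v v = g \<kappa> x *v 0"
    using assms rho_nonzero by (simp add: hessian_at_critical_point)
  moreover have "invertible (g \<kappa> x)" using metric \<kappa> x by (auto simp: metric_def)
  ultimately show ?thesis using inj_matrix_vector_mult injD by metis
qed

lemma not_product:
  assumes n: "CARD('n) \<ge> 3" and sm: "smooth_fun A u" "smooth_fun A w" and z: "u x = 0" "w x = 0"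
  shows "f \<noteq> (\<lambda>y. u y * w y)"
proof
  assume f: "f = (\<lambda>y. u y * w y)"
  have p: "coord \<kappa> x \<in> coord \<kappa> ` dom_of \<kappa>" using x by simp
  have ev: "eventually (\<lambda>p. local_rep \<kappa> h differentiable (at p)) (nhds (coord \<kappa> x))"
    and dd: "pd b (local_rep \<kappa> h) differentiable (at (coord \<kappa> x))" if "smooth_fun A h" for h b
  proof -
    have h: "smooth_in_chart \<kappa> (dom_of \<kappa>) h" using that \<kappa> by (simp add: smooth_fun_def)
    show "eventually (\<lambda>p. local_rep \<kappa> h differentiable (at p)) (nhds (coord \<kappa> x))"
      using eventually_nhds_in_open[OF open_coord_image[OF atlas \<kappa>] p]
      by eventually_elim (rule smooth_in_chartD(1)[OF atlas \<kappa> h])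
    show "pd b (local_rep \<kappa> h) differentiable (at (coord \<kappa> x))"
      by (rule smooth_in_chartD(2)[OF atlas \<kappa> h p])
  qed
  have fp: "local_rep \<kappa> f = (\<lambda>p. local_rep \<kappa> u p * local_rep \<kappa> w p)"
    unfolding f by (simp add: local_rep_def comp_def)
  have "local_rep \<kappa> u (coord \<kappa> x) = 0" "local_rep \<kappa> w (coord \<kappa> x) = 0"
    using z by (simp_all add: local_rep_coord[OF atlas \<kappa> x])
  with n ev[OF sm(1)] ev[OF sm(2)] dd[OF sm(1)] dd[OF sm(2)]
  obtain v where "v \<noteq> 0" "v v* hessian (local_rep \<kappa> f) (coord \<kappa> x) = 0"
    unfolding fp by (rule hessian_product_degenerate)
  then show False using hessian_nondegenerate by blast
qed

text \<open>Membership in the chart domain is part of the conclusion because a nonzero derivative in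
  \<open>\<kappa>\<close> contradicts a vanishing 1-jet at \<open>y\<close> only for
  \<open>y\<close> in that domain.\<close>

lemma critical_points_isolated:
  "eventually (\<lambda>y. y \<in> dom_of \<kappa> \<and> (\<exists>a. pderiv_chart \<kappa> a f y \<noteq> 0)) (at x)"
proof -
  have "eventually (\<lambda>p. grad (local_rep \<kappa> f) p \<noteq> 0) (at (coord \<kappa> x))"
    by (rule nondegenerate_critical_point_isolated)
      (use differentiable_near(2) critical_point(2) hessian_nondegenerate in auto)
  from eventually_at_coord[OF atlas \<kappa> x this] eventually_at_in_open'[OF open_dom_of[OF atlas \<kappa>] x]
  show ?thesis
    by eventually_elim (auto simp: grad_def vec_eq_iff pderiv_chart_def)
qed

lemma zero_isolated:
  assumes "riemannian A g"
  shows "eventually (\<lambda>y. f y \<noteq> 0) (at x)"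
proof -
  have "eventually (\<lambda>p. local_rep \<kappa> f p \<noteq> 0) (at (coord \<kappa> x))"
  proof (rule anisotropic_critical_point_isolated_zero)
    fix v :: "real^'n" assume "v \<noteq> 0"
    then have "v \<bullet> (g \<kappa> x *v v) > 0" using assms \<kappa> x by (auto simp: riemannian_def)
    then show "(v v* hessian (local_rep \<kappa> f) (coord \<kappa> x)) \<bullet> v \<noteq> 0"
      using rho_nonzero by (simp add: hessian_at_critical_point inner_commute)
  qed (use differentiable_near critical_point in auto)
  from eventually_at_coord[OF atlas \<kappa> x this] eventually_at_in_open'[OF open_dom_of[OF atlas \<kappa>] x]
  show ?thesis by eventually_elim (simp add: local_rep_coord[OF atlas \<kappa>])
qed

end

end

section \<open>From one scale to the conformal class\<close>

theorem proposition2p2: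
  fixes A :: "('m::{t2_space, second_countable_topology}, 'n::finite) chart set"
    and c :: "('m, 'n) tensor2 set"
    and \<sigma> :: "('m, 'n) density"
  assumes "smooth_atlas A"
    and "connected (UNIV :: 'm set)"
    and "CARD('n) \<ge> 3"
    and "conformal_class A c"
    and "\<sigma> \<in> densities A c 1"
    and "tractor_D A c \<sigma> \<noteq> zero_tractor A c"
    and "parallel_tractor A c (tractor_D A c \<sigma>)"
  shows "(\<forall>x. jet_vanishes A c 1 1 \<sigma> x \<longrightarrow>
           (\<forall>\<tau> f\<^sub>1 f\<^sub>2. \<tau> \<in> densities A c 1 \<and> smooth_fun A f\<^sub>1 \<and> smooth_fun A f\<^sub>2 \<and>
              f\<^sub>1 x = 0 \<and> f\<^sub>2 x = 0 \<longrightarrow>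
              \<sigma> \<noteq> mult_density (\<lambda>y. f\<^sub>1 y * f\<^sub>2 y) \<tau>)) \<and>
         (\<forall>x. jet_vanishes A c 1 1 \<sigma> x \<longrightarrow> x isolated_in {y. jet_vanishes A c 1 1 \<sigma> y}) \<and>
         ((\<forall>g\<in>c. riemannian A g) \<longrightarrow>
           (\<forall>x. jet_vanishes A c 1 1 \<sigma> x \<longrightarrow>
              (\<exists>U. open U \<and> x \<in> U \<and> (\<forall>y\<in>U. y \<noteq> x \<longrightarrow> (\<forall>g\<in>c. \<sigma> g y \<noteq> 0)))))"
proof -
  note A = assms(1) and conn = assms(2) and \<sigma> = assms(5)
  obtain g P \<rho> where g: "g \<in> c" and "parallel_scale A g P (\<sigma> g) \<rho>"
    using parallel_tractor_D[OF A assms(4) \<sigma> assms(7)] .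
  then interpret parallel_scale A g P "\<sigma> g" \<rho> by simp
  \<comment> \<open>If \<open>\<sigma>\<close> vanished in the scale \<open>g\<close>, it would
    vanish in every scale of the class and, by the convention for densities, off the class too; its
    tractor would then be zero.\<close>
  obtain y0 where nz: "\<sigma> g y0 \<noteq> 0"
  proof -
    have "\<exists>y. \<sigma> g y \<noteq> 0"
    proof (rule ccontr)
      assume "\<nexists>y. \<sigma> g y \<noteq> 0"
      then have z: "\<sigma> g y = 0" for y by blast
      have "\<sigma> h = zero_density h" for h
      proof (cases "h \<in> c")
        case True
        obtain \<Omega> where "\<And>x. \<sigma> h x = \<Omega> x powr 1 * \<sigma> g x"
          using density_change_scale[OF A assms(4) \<sigma> g True] by blast
        then show ?thesis using z by (simp add: zero_density_def fun_eq_iff)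
      next
        case False
        then show ?thesis using \<sigma> by (simp add: densities_def zero_density_def)
      qed
      then have "\<sigma> = zero_density" by blast
      then show False using assms(6) by (simp add: tractor_D_def zero_tractor_def)
    qed
    then show ?thesis using that by blast
  qed
  have vanishD: "\<sigma> g x = 0" "pderiv_chart \<kappa> a (\<sigma> g) x = 0"
    if "jet_vanishes A c 1 1 \<sigma> x" "\<kappa> \<in> A" "x \<in> dom_of \<kappa>" for \<kappa> x a
    using that jet_vanishes_1_iff[OF A \<sigma>] g by blast+
  show ?thesis
  proof (intro conjI allI impI)
    fix x \<tau> f\<^sub>1 f\<^sub>2
    assume x: "jet_vanishes A c 1 1 \<sigma> x"
      and f: "\<tau> \<in> densities A c 1 \<and> smooth_fun A f\<^sub>1 \<and> smooth_fun A f\<^sub>2 \<and> f\<^sub>1 x = 0 \<and> f\<^sub>2 x = 0"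
    obtain \<kappa> where \<kappa>: "\<kappa> \<in> A" "x \<in> dom_of \<kappa>" using atlas_chart[OF A] .
    \<comment> \<open>In the scale \<open>g\<close> the section \<open>\<tau>\<close> is a function;
      absorbed into the second factor, it leaves a product of two smooth functions that both vanish
      at \<open>x\<close>.\<close>
    have sm: "smooth_fun A (\<lambda>y. f\<^sub>2 y * \<tau> g y)"
      using f g by (intro smooth_fun_mult A) (auto simp: densities_def)
    have "\<sigma> g \<noteq> (\<lambda>y. f\<^sub>1 y * (f\<^sub>2 y * \<tau> g y))"
      by (rule not_product[OF conn nz \<kappa> vanishD[OF x \<kappa>] assms(3) _ sm]) (use f in auto)
    then show "\<sigma> \<noteq> mult_density (\<lambda>y. f\<^sub>1 y * f\<^sub>2 y) \<tau>"
      by (auto simp: mult_density_def mult.assoc)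
  next
    fix x assume x: "jet_vanishes A c 1 1 \<sigma> x"
    obtain \<kappa> where \<kappa>: "\<kappa> \<in> A" "x \<in> dom_of \<kappa>" using atlas_chart[OF A] .
    have "eventually (\<lambda>y. y \<notin> {y. jet_vanishes A c 1 1 \<sigma> y}) (at x)"
      using critical_points_isolated[OF conn nz \<kappa> vanishD[OF x \<kappa>]]
      by eventually_elim (use vanishD(2)[OF _ \<kappa>(1)] in blast)
    then show "x isolated_in {y. jet_vanishes A c 1 1 \<sigma> y}"
      using x by (simp add: isolated_in_altdef)
  next
    fix x assume r: "\<forall>g\<in>c. riemannian A g" and x: "jet_vanishes A c 1 1 \<sigma> x"
    obtain \<kappa> where \<kappa>: "\<kappa> \<in> A" "x \<in> dom_of \<kappa>" using atlas_chart[OF A] .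
    have "eventually (\<lambda>y. \<sigma> g y \<noteq> 0) (at x)"
      by (rule zero_isolated[OF conn nz \<kappa> vanishD[OF x \<kappa>]]) (use r g in blast)
    then obtain U where U: "open U" "x \<in> U" "\<And>y. y \<in> U \<Longrightarrow> y \<noteq> x \<Longrightarrow> \<sigma> g y \<noteq> 0"
      unfolding eventually_at_topological by blast
    have "\<sigma> h y \<noteq> 0" if "h \<in> c" "y \<in> U" "y \<noteq> x" for h y
    proof -
      obtain \<Omega> where "\<And>x. \<Omega> x > 0" "\<And>x. \<sigma> h x = \<Omega> x powr 1 * \<sigma> g x"
        using density_change_scale[OF A assms(4) \<sigma> g \<open>h \<in> c\<close>] by blast
      then show ?thesis using U(3)[OF that(2,3)] by (metis less_irrefl mult_eq_0_iff powr_gt_zero)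
    qed
    with U show "\<exists>U. open U \<and> x \<in> U \<and> (\<forall>y\<in>U. y \<noteq> x \<longrightarrow> (\<forall>g\<in>c. \<sigma> g y \<noteq> 0))" by blast
  qed
qed

end
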